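(* Let $d\ge 2$ and $t\ge d^2-d+3$ be integers, and let $T_t$ be a tree on $t$ vertices. Let $$n=\alpha(t-1)+\beta,\qquad \alpha\ge 1,\qquad 0\le\beta\le t-2,$$ with $\alpha,\beta$ integers. Then $$\operatorname{ex}(n,K_{t-d},T_t)=\alpha\binom{t-1}{t-d}+\binom{\beta}{t-d}.$$ Moreover, the extremal graphs (the $n$-vertex $T_t$-free graphs with exactly $\operatorname{ex}(n,K_{t-d},T_t)$ copies of $K_{t-d}$) are exactly the following: (i) if $0\le\beta<t-d$, the graphs $\alpha K_{t-1}\,\dot\cup\, H$, where $H$ is any graph on $\beta$ vertices; (ii) if $t-d\le\beta\le t-2$, the graph $\alpha K_{t-1}\,\dot\cup\, K_\beta$.
   Context: All graphs are finite, simple and undirected. $K_m$ is the complete graph on $m$ vertices ($K_0$ is the empty graph with no vertices). A graph $G$ is $F$-free if it contains no (not necessarily induced) subgraph isomorphic to $F$. For graphs $H,F$, $\operatorname{ex}(n,H,F)$ is the maximum number of copies of $H$ (as subgraphs) in an $n$-vertex $F$-free graph. $G_1\dot\cup G_2$ is the vertex-disjoint union, with no edges between the two graphs, and $mG$ is the disjoint union of $m$ copies of $G$. $\binom{a}{b}=0$ when $0\le a<b$. Extremal graphs are described up to isomorphism. *)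

theory Defs
  imports Main
begin

(* Finite simple undirected graphs: an edge is a two-element set of vertices.  The Graph_Theory
   entry is not used because its tree notion lives on digraphs, where the two arcs representing
   an undirected edge already form a cycle. *)

datatype 'a graph = Graph (verts: "'a set") (edges: "'a set set")

definition simple_graph :: "'a graph \<Rightarrow> bool" where
  "simple_graph G \<longleftrightarrow> finite (verts G) \<and> (\<forall>e\<in>edges G. e \<subseteq> verts G \<and> card e = 2)"

definition subgraph :: "'a graph \<Rightarrow> 'a graph \<Rightarrow> bool" where
  "subgraph S G \<longleftrightarrow> simple_graph S \<and> verts S \<subseteq> verts G \<and> edges S \<subseteq> edges G"

(* Intended for simple graphs, where a vertex bijection carrying the edge set onto the edge set
   is precisely an isomorphism. *)
definition graph_iso :: "'a graph \<Rightarrow> 'b graph \<Rightarrow> bool" where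
  "graph_iso G H \<longleftrightarrow> (\<exists>f. bij_betw f (verts G) (verts H) \<and> (\<lambda>e. f ` e) ` edges G = edges H)"

definition free_of :: "'b graph \<Rightarrow> 'a graph \<Rightarrow> bool" where
  "free_of F G \<longleftrightarrow> \<not> (\<exists>S. subgraph S G \<and> graph_iso S F)"

definition num_copies :: "'b graph \<Rightarrow> 'a graph \<Rightarrow> nat" where
  "num_copies H G = card {S. subgraph S G \<and> graph_iso S H}"

(* The graphs range over all n-vertex simple graphs with natural numbers as vertices, i.e. over
   all n-vertex graphs up to isomorphism; hence the maximum is over a finite set of values. *)
definition ex_number :: "nat \<Rightarrow> 'b graph \<Rightarrow> 'c graph \<Rightarrow> nat" where
  "ex_number n H F =
     Max {num_copies H G | G :: nat graph. simple_graph G \<and> card (verts G) = n \<and> free_of F G}"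

definition extremal :: "nat \<Rightarrow> 'b graph \<Rightarrow> 'c graph \<Rightarrow> 'a graph \<Rightarrow> bool" where
  "extremal n H F G \<longleftrightarrow> simple_graph G \<and> card (verts G) = n \<and> free_of F G
     \<and> num_copies H G = ex_number n H F"

definition connected_graph :: "'a graph \<Rightarrow> bool" where
  "connected_graph G \<longleftrightarrow> verts G \<noteq> {} \<and>
     (\<forall>u\<in>verts G. \<forall>v\<in>verts G. (u, v) \<in> {(x, y). {x, y} \<in> edges G}\<^sup>*)"

(* A cycle is given by the list of its vertices, without repeating the first one at the end. *)
definition is_cycle :: "'a graph \<Rightarrow> 'a list \<Rightarrow> bool" where
  "is_cycle G vs \<longleftrightarrow> length vs \<ge> 3 \<and> distinct vs \<and>
     (\<forall>i<length vs. {vs ! i, vs ! (Suc i mod length vs)} \<in> edges G)"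

definition is_tree :: "'a graph \<Rightarrow> bool" where
  "is_tree T \<longleftrightarrow> simple_graph T \<and> connected_graph T \<and> \<not> (\<exists>vs. is_cycle T vs)"

definition complete_graph :: "nat \<Rightarrow> nat graph" where
  "complete_graph m = Graph {..<m} {e. e \<subseteq> {..<m} \<and> card e = 2}"

definition disjoint_union :: "'a graph \<Rightarrow> 'b graph \<Rightarrow> ('a + 'b) graph" where
  "disjoint_union G H = Graph (verts G <+> verts H)
     ((\<lambda>e. Inl ` e) ` edges G \<union> (\<lambda>e. Inr ` e) ` edges H)"

definition disjoint_copies :: "nat \<Rightarrow> 'a graph \<Rightarrow> (nat \<times> 'a) graph" where
  "disjoint_copies m G = Graph ({..<m} \<times> verts G) {Pair i ` e | i e. i < m \<and> e \<in> edges G}"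

end

theory Submission
  imports Defs
begin

text \<open>
  Write \<open>k = t - d\<close> and \<open>m = t - 1\<close>, so that \<open>k\<close> is close to \<open>t\<close>, and let \<open>G\<close> be \<open>T\<close>-free on
  \<open>n\<close> vertices. The \<open>k\<close>-cliques of \<open>G\<close> fall into clusters that live on pairwise disjoint vertex
  sets with at most \<open>m\<close> vertices each. So \<open>G\<close> has at most as many \<open>k\<close>-cliques as
  disjoint complete graphs on these vertex sets would have, and \<open>x choose k\<close> is convex in \<open>x\<close>:
  the best choice is to fill as many sets as possible up to size \<open>m\<close>.

  The clusters come from two ways of finding \<open>T\<close> in \<open>G\<close>. First, every tree with more than \<open>d\<close>
  vertices has a vertex \<open>v\<close> such that some union of components of \<open>T - v\<close> has between \<open>d\<close> and \<open>2 * d - 2\<close> vertices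
  (\<open>closed_part_of_medium_size\<close>). If two \<open>k\<close>-cliques meet and their union has at least \<open>t\<close>
  vertices, then \<open>v\<close> goes to a common vertex, that part of \<open>T\<close> into one clique, and the rest into
  the other (\<open>card_union_meeting_kcliques\<close>). So meeting \<open>k\<close>-cliques \<open>A\<close> and \<open>B\<close> satisfy
  \<open>card (A - B) < d\<close>. Since \<open>k \<ge> 2 * d - 1\<close>, two \<open>k\<close>-cliques that meet a third one share one of its
  vertices: meeting is an equivalence relation, and different classes span disjoint vertex sets.

  Second, every forest with at least \<open>2 * d\<close> vertices has \<open>d\<close> independent vertices with at most
  \<open>d\<close> neighbours altogether (\<open>small_neighbourhood\<close>). Suppose that a class spans at least \<open>t\<close>
  vertices. Among its members choose \<open>A0\<close>, \<open>A1\<close> that maximize \<open>j = card (A0 - A1)\<close>, and then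
  members that contain further vertices, until \<open>d\<close> vertices outside \<open>A0\<close> are covered.
  The members chosen after \<open>A1\<close> remove at most \<open>j - 1\<close> vertices each from \<open>A0 \<inter> A1\<close>, and
  \<open>t \<ge> d\<^sup>2 - d + 3\<close> guarantees that \<open>d\<close> vertices survive in the common intersection. Put the \<open>d\<close>
  independent vertices of \<open>T\<close> outside \<open>A0\<close>, their neighbours into the common intersection, and the
  rest of \<open>T\<close> into \<open>A0\<close>: again \<open>T\<close> occurs in \<open>G\<close>
  (\<open>card_Union_pairwise_meeting_kcliques\<close>).

  If the bound is attained, then strict convexity forces \<open>\<alpha>\<close> clusters of size \<open>m\<close> and, when
  \<open>k \<le> \<beta>\<close>, one more of size \<open>\<beta>\<close>, and every cluster is a clique. No edge leaves a clique of size
  \<open>t - 1\<close>, since that edge could carry a leaf of \<open>T\<close>. Conversely, a disjoint union of graphs with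
  fewer than \<open>t\<close> vertices each is \<open>T\<close>-free because \<open>T\<close> is connected.
\<close>

section \<open>Trees as parent functions\<close>

definition path_in :: "'a graph \<Rightarrow> 'a set \<Rightarrow> 'a list \<Rightarrow> bool" where
  "path_in G S vs \<longleftrightarrow> vs \<noteq> [] \<and> distinct vs \<and> set vs \<subseteq> S \<and> successively (\<lambda>u v. {u, v} \<in> edges G) vs"

text \<open>
  This is the only way in which acyclicity enters: a vertex outside a connected set has at most
  one neighbour in it.
\<close>
lemma cycle_of_path:
  assumes P: "path_in G S vs" and v: "v \<notin> S" and ne: "hd vs \<noteq> last vs"
    and e: "{v, hd vs} \<in> edges G" "{last vs, v} \<in> edges G"
  shows "is_cycle G (v # vs)"
proof -
  from P have P': "vs \<noteq> []" "distinct vs" "set vs \<subseteq> S" "successively (\<lambda>u v. {u, v} \<in> edges G) vs"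
    by (auto simp: path_in_def)
  have len: "length vs \<ge> 2"
    using P'(1) ne by (cases vs; cases "tl vs") auto
  have succ: "successively (\<lambda>u v. {u, v} \<in> edges G) (v # vs)"
    using P' e(1) by (cases vs) auto
  have "{(v # vs) ! i, (v # vs) ! (Suc i mod length (v # vs))} \<in> edges G" if i: "i < length (v # vs)" for i
  proof (cases "i = length vs")
    case True
    then show ?thesis using e(2) P'(1) by (simp add: last_conv_nth nth_Cons')
  next
    case False
    with i have "Suc i < length (v # vs)" by simp
    with succ show ?thesis
      unfolding successively_conv_nth by simp
  qed
  then show ?thesis
    unfolding is_cycle_def using len P' v by auto
qed

lemma path_in_extend:
  assumes "s \<in> S" "{s, v} \<in> edges G" "v \<notin> S"
    and "\<And>u w. u \<in> S \<Longrightarrow> w \<in> S \<Longrightarrow> \<exists>vs. path_in G S vs \<and> hd vs = u \<and> last vs = w"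
    and "u \<in> insert v S" "w \<in> insert v S"
  shows "\<exists>vs. path_in G (insert v S) vs \<and> hd vs = u \<and> last vs = w"
proof -
  consider "u = v" "w = v" | "u = v" "w \<in> S" | "u \<in> S" "w = v" | "u \<in> S" "w \<in> S"
    using assms(5,6) by auto
  then show ?thesis
  proof cases
    case 1
    then show ?thesis by (intro exI[of _ "[v]"]) (auto simp: path_in_def)
  next
    case 2
    then obtain vs where "path_in G S vs" "hd vs = s" "last vs = w" using assms(1,4) by blast
    then show ?thesis using 2 assms(2,3)
      by (intro exI[of _ "v # vs"]) (auto simp: path_in_def successively_Cons insert_commute)
  next
    case 3
    then obtain vs where "path_in G S vs" "hd vs = u" "last vs = s" using assms(1,4) by blast
    then show ?thesis using 3 assms(2,3)
      by (intro exI[of _ "vs @ [v]"]) (auto simp: path_in_def successively_append_iff)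
  next
    case 4
    then obtain vs where "path_in G S vs" "hd vs = u" "last vs = w" using assms(4) by blast
    then show ?thesis by (intro exI[of _ "vs"]) (auto simp: path_in_def)
  qed
qed

lemma edge_leaving_proper_subset:
  assumes "connected_graph G" "S \<subseteq> verts G" "S \<noteq> {}" "S \<noteq> verts G" "simple_graph G"
  shows "\<exists>s v. s \<in> S \<and> v \<in> verts G - S \<and> {s, v} \<in> edges G"
proof -
  obtain a b where ab: "a \<in> S" "b \<in> verts G" "b \<notin> S" using assms by blast
  then have "(a, b) \<in> {(x, y). {x, y} \<in> edges G}\<^sup>*"
    using assms unfolding connected_graph_def by blast
  then have "b \<in> S \<or> (\<exists>s v. s \<in> S \<and> v \<notin> S \<and> {s, v} \<in> edges G)"
    using ab(1) by (induction rule: rtrancl_induct) auto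
  with ab show ?thesis using assms(5) unfolding simple_graph_def by blast
qed

text \<open>
  A tree can be listed so that every vertex but the first is adjacent to exactly one earlier
  vertex, its parent. Grow the list along edges that leave it; the listed vertices stay connected
  by paths among themselves, so a second earlier neighbour would close a cycle. After this lemma
  the tree is just a function \<open>p\<close> with \<open>p i < i\<close>.
\<close>
lemma tree_enumeration:
  assumes T: "is_tree T" and t: "card (verts T) = t"
  obtains x p where "bij_betw x {..<t} (verts T)" "\<And>i. 0 < i \<Longrightarrow> i < t \<Longrightarrow> p i < (i::nat)"
    "edges T = {{x i, x (p i)} | i. 0 < i \<and> i < t}"
proof -
  have sT: "simple_graph T" and cT: "connected_graph T" and aT: "\<And>vs. \<not> is_cycle T vs"
    using T by (auto simp: is_tree_def)
  have fin: "finite (verts T)" using sT by (simp add: simple_graph_def)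
  have ne: "verts T \<noteq> {}" using cT by (simp add: connected_graph_def)
  have grow: "\<exists>x p. inj_on x {..<Suc m} \<and> x ` {..<Suc m} \<subseteq> verts T \<and>
      (\<forall>i. 0 < i \<longrightarrow> i < Suc m \<longrightarrow> p i < i \<and> {x i, x (p i)} \<in> edges T \<and> (\<forall>j<i. {x j, x i} \<in> edges T \<longrightarrow> j = p i)) \<and>
      (\<forall>u\<in>x ` {..<Suc m}. \<forall>w\<in>x ` {..<Suc m}. \<exists>vs. path_in T (x ` {..<Suc m}) vs \<and> hd vs = u \<and> last vs = w)"
    if "Suc m \<le> t" for m
    using that
  proof (induction m)
    case 0
    obtain r where r: "r \<in> verts T" using ne by auto
    then have "path_in T {r} [r]" by (simp add: path_in_def)
    with r show ?case
      by (intro exI[of _ "\<lambda>_. r"] exI[of _ id]) (auto simp: inj_on_def lessThan_Suc intro: exI[of _ "[r]"])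
  next
    case (Suc m)
    from Suc.IH[OF Suc_leD[OF Suc.prems]]
    obtain x p where inj: "inj_on x {..<Suc m}" and sub: "x ` {..<Suc m} \<subseteq> verts T"
      and par: "\<forall>i. 0 < i \<longrightarrow> i < Suc m \<longrightarrow> p i < i \<and> {x i, x (p i)} \<in> edges T \<and> (\<forall>j<i. {x j, x i} \<in> edges T \<longrightarrow> j = p i)"
      and con: "\<forall>u\<in>x ` {..<Suc m}. \<forall>w\<in>x ` {..<Suc m}. \<exists>vs. path_in T (x ` {..<Suc m}) vs \<and> hd vs = u \<and> last vs = w"
      by (elim exE conjE) (rule that)
    let ?S = "x ` {..<Suc m}"
    have "card ?S = Suc m" using inj by (simp add: card_image)
    then have "?S \<noteq> verts T" using Suc.prems t by auto
    then obtain s v where s: "s \<in> ?S" and v: "v \<in> verts T" "v \<notin> ?S" and sv: "{s, v} \<in> edges T"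
      using edge_leaving_proper_subset[OF cT sub _ _ sT] by blast
    from s obtain j where j: "j < Suc m" "s = x j" by blast
    define x' where "x' = x(Suc m := v)"
    define p' where "p' = p(Suc m := j)"
    have im: "x' ` {..<Suc (Suc m)} = insert v ?S"
      by (auto simp: x'_def lessThan_Suc)
    have inj': "inj_on x' {..<Suc (Suc m)}"
      using inj v(2) unfolding x'_def lessThan_Suc[of "Suc m"] by (auto simp: inj_on_def)
    \<comment> \<open>A second earlier neighbour of \<open>v\<close> would close a cycle with the path to \<open>s\<close> among the listed vertices.\<close>
    have uniq: "l = j" if l: "l < Suc m" "{x l, v} \<in> edges T" for l
    proof (rule ccontr)
      assume "l \<noteq> j"
      with inj that(1) j have "x l \<noteq> s" by (auto simp: inj_on_def)
      moreover obtain vs where vs: "path_in T ?S vs" "hd vs = s" "last vs = x l"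
        using bspec[OF bspec[OF con s], OF imageI[of l "{..<Suc m}" x]] l(1) by auto
      ultimately have "is_cycle T (v # vs)"
        using cycle_of_path[OF vs(1) v(2)] sv that(2) by (simp add: insert_commute)
      with aT show False by blast
    qed
    have par': "p' i < i \<and> {x' i, x' (p' i)} \<in> edges T \<and> (\<forall>l<i. {x' l, x' i} \<in> edges T \<longrightarrow> l = p' i)"
      if i: "0 < i" "i < Suc (Suc m)" for i
    proof (cases "i = Suc m")
      case True
      have "{v, x j} \<in> edges T" using sv j(2) by (simp add: insert_commute)
      moreover have "x' l = x l" if "l < i" for l using that True by (simp add: x'_def)
      ultimately show ?thesis using True j(1) uniq by (simp add: x'_def p'_def)
    next
      case False
      then have "i < Suc m" using i by simp
      then show ?thesis using spec[OF par, of i] i by (auto simp: x'_def p'_def)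
    qed
    have con': "\<forall>u\<in>insert v ?S. \<forall>w\<in>insert v ?S. \<exists>vs. path_in T (insert v ?S) vs \<and> hd vs = u \<and> last vs = w"
      using path_in_extend[OF s sv v(2) con[rule_format]] by (intro ballI)
    have sub': "insert v ?S \<subseteq> verts T" using sub v by blast
    show ?case
      using inj' sub' par' con' unfolding im[symmetric]
      by (intro exI[of _ x'] exI[of _ p'] conjI allI impI) simp_all
  qed
  have "t > 0" using t fin ne card_gt_0_iff by blast
  then obtain m where m: "t = Suc m" by (cases t) auto
  obtain x p where inj: "inj_on x {..<t}" and sub: "x ` {..<t} \<subseteq> verts T"
    and par: "\<forall>i. 0 < i \<longrightarrow> i < t \<longrightarrow> p i < i \<and> {x i, x (p i)} \<in> edges T \<and> (\<forall>j<i. {x j, x i} \<in> edges T \<longrightarrow> j = p i)"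
    using grow[of m, folded m, OF order_refl] by (elim exE conjE) (rule that)
  have im: "x ` {..<t} = verts T"
    using inj sub fin t by (intro card_subset_eq) (auto simp: card_image)
  have "edges T = {{x i, x (p i)} | i. 0 < i \<and> i < t}"
  proof (intro set_eqI iffI)
    fix e assume e: "e \<in> edges T"
    then have "e \<subseteq> verts T" "card e = 2" using sT by (auto simp: simple_graph_def)
    then obtain u w where uw: "e = {u, w}" "u \<noteq> w" "u \<in> verts T" "w \<in> verts T"
      by (auto simp: card_2_iff)
    obtain a b where ab: "a < t" "b < t" "u = x a" "w = x b" using uw im by blast
    have "a \<noteq> b" using ab uw by auto
    have *: "a' = p b'" if "a' < b'" "b' < t" "e = {x a', x b'}" for a' b'
      using par that e by auto
    consider "a < b" | "b < a" using \<open>a \<noteq> b\<close> by linarith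
    then show "e \<in> {{x i, x (p i)} | i. 0 < i \<and> i < t}"
    proof cases
      case 1
      then have "a = p b" using *[of a b] ab uw by auto
      then show ?thesis using 1 uw ab by (auto simp: insert_commute intro!: exI[of _ b])
    next
      case 2
      then have "b = p a" using *[of b a] ab uw by (auto simp: insert_commute)
      then show ?thesis using 2 uw ab by (auto simp: insert_commute intro!: exI[of _ a])
    qed
  qed (use par in auto)
  moreover have "bij_betw x {..<t} (verts T)" using inj im by (simp add: bij_betw_def)
  ultimately show ?thesis using that[of x p] par by blast
qed

text \<open>
  The function \<open>p\<close> stands for the tree on \<open>{..<t}\<close> with the edges \<open>{i, p i}\<close> for \<open>i > 0\<close>; its values at
  \<open>0\<close> and from \<open>t\<close> on are arbitrary.
\<close>
definition embeds :: "nat \<Rightarrow> (nat \<Rightarrow> nat) \<Rightarrow> 'a graph \<Rightarrow> bool" where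
  "embeds t p G \<longleftrightarrow> (\<exists>f. inj_on f {..<t} \<and> f ` {..<t} \<subseteq> verts G \<and>
      (\<forall>i. 0 < i \<longrightarrow> i < t \<longrightarrow> {f i, f (p i)} \<in> edges G))"

lemma free_of_iff_not_embeds:
  assumes G: "simple_graph G" and x: "bij_betw x {..<t} (verts T)"
    and p: "\<And>i. 0 < i \<Longrightarrow> i < t \<Longrightarrow> p i < (i::nat)"
    and E: "edges T = {{x i, x (p i)} | i. 0 < i \<and> i < t}"
  shows "free_of T G \<longleftrightarrow> \<not> embeds t p G"
proof -
  have "embeds t p G" if S: "subgraph S G" and iso: "graph_iso S T" for S
  proof -
    obtain h where h: "bij_betw h (verts S) (verts T)" and hE: "(\<lambda>e. h ` e) ` edges S = edges T"
      using iso by (auto simp: graph_iso_def)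
    define g where "g = inv_into (verts S) h"
    have g: "bij_betw g (verts T) (verts S)" unfolding g_def using h by (rule bij_betw_inv_into)
    have gf: "bij_betw (g \<circ> x) {..<t} (verts S)" using x g by (rule bij_betw_trans)
    have "{g (x i), g (x (p i))} \<in> edges G" if i: "0 < i" "i < t" for i
    proof -
      have "{x i, x (p i)} \<in> edges T" using E i by blast
      then obtain e where e: "e \<in> edges S" "h ` e = {x i, x (p i)}" unfolding hE[symmetric] by (elim imageE) simp
      have "e \<subseteq> verts S" using S e by (auto simp: subgraph_def simple_graph_def)
      then have "g ` h ` e = e" unfolding g_def using h 
        by (meson bij_betw_def inv_into_image_cancel)
      then show ?thesis using e S by (auto simp: subgraph_def)
    qed
    then show ?thesis unfolding embeds_def using gf S
      by (intro exI[of _ "g \<circ> x"]) (auto simp: bij_betw_def subgraph_def)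
  qed
  moreover have "\<exists>S. subgraph S G \<and> graph_iso S T" if emb: "embeds t p G"
  proof -
    obtain f where f: "inj_on f {..<t}" "f ` {..<t} \<subseteq> verts G"
      "\<And>i. 0 < i \<Longrightarrow> i < t \<Longrightarrow> {f i, f (p i)} \<in> edges G" using emb by (auto simp: embeds_def)
    define S where "S = Graph (f ` {..<t}) {{f i, f (p i)} | i. 0 < i \<and> i < t}"
    define h where "h = x \<circ> inv_into {..<t} f"
    have pt: "p i < t" if "0 < i" "i < t" for i using p[OF that] that by simp
    have "f i \<noteq> f (p i)" if "0 < i" "i < t" for i
      using inj_onD[OF f(1), of i "p i"] p[OF that] pt[OF that] that by auto
    then have "simple_graph S" unfolding simple_graph_def S_def using pt by auto
    then have "subgraph S G" using f by (auto simp: subgraph_def S_def)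
    moreover have "graph_iso S T"
    proof -
      have "bij_betw f {..<t} (f ` {..<t})" using f by (simp add: bij_betw_def)
      then have "bij_betw h (verts S) (verts T)" unfolding h_def S_def graph.sel
        using bij_betw_inv_into bij_betw_trans x by blast
      moreover have hf: "h (f i) = x i" if "i < t" for i
        unfolding h_def using f(1) that by simp
      have "(\<lambda>e. h ` e) ` edges S = edges T"
      proof (rule set_eqI)
        fix e
        have "e \<in> (\<lambda>e. h ` e) ` edges S \<longleftrightarrow> (\<exists>i. 0 < i \<and> i < t \<and> e = {h (f i), h (f (p i))})"
          by (auto simp: S_def image_iff)
        also have "\<dots> \<longleftrightarrow> (\<exists>i. 0 < i \<and> i < t \<and> e = {x i, x (p i)})"
          using hf pt by (intro ex_cong1 conj_cong refl) simp
        finally show "e \<in> (\<lambda>e. h ` e) ` edges S \<longleftrightarrow> e \<in> edges T" by (auto simp: E)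
      qed
      ultimately show ?thesis by (auto simp: graph_iso_def)
    qed
    ultimately show ?thesis by blast
  qed
  ultimately show ?thesis by (auto simp: free_of_def)
qed

section \<open>Pieces of a tree and a way to embed them\<close>

definition tree_adj :: "(nat \<Rightarrow> nat) \<Rightarrow> nat \<Rightarrow> nat \<Rightarrow> bool" where
  "tree_adj p i j \<longleftrightarrow> 0 < i \<and> j = p i \<or> 0 < j \<and> i = p j"

definition clique :: "'a graph \<Rightarrow> 'a set \<Rightarrow> bool" where
  "clique G C \<longleftrightarrow> C \<subseteq> verts G \<and> (\<forall>x\<in>C. \<forall>y\<in>C. x \<noteq> y \<longrightarrow> {x, y} \<in> edges G)"

definition joined :: "'a graph \<Rightarrow> 'a set \<Rightarrow> 'a set \<Rightarrow> bool" where
  "joined G X Y \<longleftrightarrow> (\<forall>x\<in>X. \<forall>y\<in>Y. {x, y} \<in> edges G)"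

lemma tree_adj_sym: "tree_adj p i j \<longleftrightarrow> tree_adj p j i"
  by (auto simp: tree_adj_def)

lemma clique_subset: "clique G C \<Longrightarrow> C' \<subseteq> C \<Longrightarrow> clique G C'"
  by (auto simp: clique_def)

lemma inj_on_into:
  assumes "finite X" "finite D" "card D \<le> card X"
  obtains f where "inj_on f D" "f ` D \<subseteq> X"
  using card_le_inj[OF assms(2,1,3)] by blast

text \<open>
  All embeddings below have this shape. The set \<open>N\<close> separates \<open>D\<close> from \<open>R\<close> in the tree. The host
  has a clique for \<open>N\<close> and \<open>R\<close>, and a set \<open>X\<close> for \<open>D\<close> that is completely joined to the image of
  \<open>N\<close>. So any injections will do, provided that \<open>D\<close> spans no edge or \<open>X\<close> is a clique.
\<close>
lemma embeds_three_parts: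
  assumes p: "\<And>i. 0 < i \<Longrightarrow> i < t \<Longrightarrow> p i < i"
    and DNR: "{..<t} = D \<union> N \<union> R" "D \<inter> N = {}" "D \<inter> R = {}" "N \<inter> R = {}"
    and sep: "\<And>i j. i \<in> D \<Longrightarrow> j \<in> R \<Longrightarrow> \<not> tree_adj p i j"
    and disj: "X \<inter> Y = {}" "X \<inter> Z = {}" "Y \<inter> Z = {}"
    and fin: "finite X" "finite Y" "finite Z"
    and card: "card D \<le> card X" "card N \<le> card Y" "card R \<le> card Z"
    and YZ: "clique G (Y \<union> Z)" and X: "X \<subseteq> verts G" and XY: "joined G X Y"
    and D: "clique G X \<or> (\<forall>i\<in>D. \<forall>j\<in>D. \<not> tree_adj p i j)"
  shows "embeds t p G"
proof -
  have "finite ({..<t})" by simp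
  then have finD: "finite D" "finite N" "finite R" unfolding DNR(1) by auto
  obtain f where f: "inj_on f D" "f ` D \<subseteq> X" using inj_on_into[OF fin(1) finD(1) card(1)] .
  obtain g where g: "inj_on g N" "g ` N \<subseteq> Y" using inj_on_into[OF fin(2) finD(2) card(2)] .
  obtain h where h: "inj_on h R" "h ` R \<subseteq> Z" using inj_on_into[OF fin(3) finD(3) card(3)] .
  define F where "F i = (if i \<in> D then f i else if i \<in> N then g i else h i)" for i
  have FD: "F i = f i" "F i \<in> X" if "i \<in> D" for i using that f by (auto simp: F_def)
  have FN: "F i = g i" "F i \<in> Y" if "i \<in> N" for i using that g DNR by (auto simp: F_def)
  have FR: "F i = h i" "F i \<in> Z" if "i \<in> R" for i using that h DNR by (auto simp: F_def)
  have inj: "inj_on F {..<t}"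
  proof (rule inj_onI)
    fix i j assume ij: "i \<in> {..<t}" "j \<in> {..<t}" and eq: "F i = F j"
    have "F i \<in> X \<longleftrightarrow> i \<in> D" "F i \<in> Y \<longleftrightarrow> i \<in> N" "F i \<in> Z \<longleftrightarrow> i \<in> R"
         "F j \<in> X \<longleftrightarrow> j \<in> D" "F j \<in> Y \<longleftrightarrow> j \<in> N" "F j \<in> Z \<longleftrightarrow> j \<in> R"
      using ij FD FN FR disj unfolding DNR(1) by blast+
    then consider "i \<in> D" "j \<in> D" | "i \<in> N" "j \<in> N" | "i \<in> R" "j \<in> R"
      using ij eq unfolding DNR(1) by auto
    then show "i = j"
      using eq f(1) g(1) h(1) FD FN FR by cases (auto simp: inj_on_def)
  qed
  have edge: "{F i, F j} \<in> edges G" if ij: "i < t" "j < t" "tree_adj p i j" "i \<noteq> j" for i j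
  proof -
    have ne: "F i \<noteq> F j" using ij inj by (auto simp: inj_on_def)
    have mem: "i \<in> D \<or> i \<in> N \<union> R" "j \<in> D \<or> j \<in> N \<union> R" using ij DNR(1) by auto
    have 1: "{F a, F b} \<in> edges G" if "a \<in> D" "b \<in> N \<union> R" "tree_adj p a b" for a b
    proof -
      have "b \<in> N" using that sep by blast
      then show ?thesis using that FD FN XY by (auto simp: joined_def)
    qed
    have 2: "{F i, F j} \<in> edges G" if "i \<in> N \<union> R" "j \<in> N \<union> R"
    proof -
      have "F i \<in> Y \<union> Z" "F j \<in> Y \<union> Z" using that FN FR by blast+
      then show ?thesis using YZ ne by (auto simp: clique_def)
    qed
    have 3: "{F i, F j} \<in> edges G" if "i \<in> D" "j \<in> D"
      using that D FD(2) ne ij by (auto simp: clique_def)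
    consider "i \<in> D" "j \<in> D" | "i \<in> D" "j \<in> N \<union> R" | "j \<in> D" "i \<in> N \<union> R" | "i \<in> N \<union> R" "j \<in> N \<union> R"
      using mem by blast
    then show ?thesis
    proof cases
      case 3
      then have "{F j, F i} \<in> edges G" using 1 ij(3) tree_adj_sym by metis
      then show ?thesis by (simp add: insert_commute)
    qed (use 1 2 3 ij(3) in blast)+
  qed
  have "X \<union> (Y \<union> Z) \<subseteq> verts G" using X YZ by (simp add: clique_def)
  then have "F ` {..<t} \<subseteq> verts G"
    using FD(2) FN(2) FR(2) unfolding DNR(1) by blast
  moreover have "{F i, F (p i)} \<in> edges G" if "0 < i" "i < t" for i
    using edge[of i "p i"] p[OF that] that by (auto simp: tree_adj_def)
  ultimately show ?thesis using inj by (auto simp: embeds_def)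
qed

text \<open>
  Induction on \<open>d\<close>: the largest vertex \<open>x\<close> of \<open>X\<close> has no neighbour in \<open>X\<close> except possibly its
  parent. Put \<open>x\<close> into \<open>D\<close> and its parent into \<open>N\<close>, and remove both; this uses up at most two vertices
  of \<open>X\<close>.
\<close>
lemma small_neighbourhood:
  assumes p: "\<And>i. 0 < i \<Longrightarrow> i < t \<Longrightarrow> p i < i"
  shows "X \<subseteq> {..<t} \<Longrightarrow> 2 * d \<le> card X \<Longrightarrow>
    \<exists>D N. D \<subseteq> X \<and> N \<subseteq> X \<and> D \<inter> N = {} \<and> card D = d \<and> card N \<le> d \<and>
      (\<forall>i\<in>D. \<forall>j\<in>X. tree_adj p i j \<longrightarrow> j \<in> N)"
proof (induction d arbitrary: X)
  case 0
  then show ?case by (intro exI[of _ "{}"]) auto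
next
  case (Suc d)
  have fin: "finite X" using Suc.prems(1) finite_subset by blast
  have "X \<noteq> {}" using Suc.prems(2) by auto
  define x where "x = Max X"
  have x: "x \<in> X" "\<And>y. y \<in> X \<Longrightarrow> y \<le> x" using fin \<open>X \<noteq> {}\<close> by (auto simp: x_def)
  have xadj: "j = p x" if "tree_adj p x j" "j \<in> X" for j
  proof -
    have "j < t" "j \<le> x" using that(2) x Suc.prems(1) by auto
    then show ?thesis using that(1) p[of j] by (auto simp: tree_adj_def)
  qed
  define X' where "X' = X - {x, p x}"
  have "card X - card {x, p x} \<le> card X'"
    unfolding X'_def by (rule diff_card_le_card_Diff) simp
  moreover have "card {x, p x} \<le> 2" by (simp add: card_insert_if)
  ultimately have "2 * d \<le> card X'" using Suc.prems(2) by simp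
  moreover have "X' \<subseteq> {..<t}" using Suc.prems(1) by (auto simp: X'_def)
  ultimately obtain D N where DN: "D \<subseteq> X'" "N \<subseteq> X'" "D \<inter> N = {}" "card D = d" "card N \<le> d"
      "\<forall>i\<in>D. \<forall>j\<in>X'. tree_adj p i j \<longrightarrow> j \<in> N"
    using Suc.IH[of X'] by blast
  have finDN: "finite D" "finite N" using DN fin X'_def finite_subset[of _ X] by blast+
  define N' where "N' = N \<union> (if p x \<in> X - {x} then {p x} else {})"
  have "x \<notin> D" using DN by (auto simp: X'_def)
  have xx: "\<not> tree_adj p x x" using x Suc.prems(1) p[of x] by (auto simp: tree_adj_def)
  have "tree_adj p i j \<longrightarrow> j \<in> N'" if i: "i \<in> insert x D" and j: "j \<in> X" for i j
  proof
    assume a: "tree_adj p i j"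
    show "j \<in> N'"
    proof (cases "i = x")
      case True
      then have "j = p x" using xadj a j by blast
      moreover have "j \<noteq> x" using a True xx by auto
      ultimately show ?thesis using j by (auto simp: N'_def)
    next
      case False
      then have iD: "i \<in> D" using i by simp
      show ?thesis
      proof (cases "j \<in> X'")
        case True
        then show ?thesis using DN(6) iD a by (auto simp: N'_def)
      next
        case F: False
        have "j \<noteq> x"
        proof
          assume "j = x"
          then have "tree_adj p x i" using a tree_adj_sym by blast
          moreover have "i \<in> X" using iD DN(1) by (auto simp: X'_def)
          ultimately have "i = p x" using xadj by blast
          then show False using iD DN(1) by (auto simp: X'_def)
        qed
        then show ?thesis using F j by (auto simp: X'_def N'_def)
      qed
    qed
  qed
  moreover have "insert x D \<inter> N' = {}" "insert x D \<subseteq> X" "N' \<subseteq> X"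
    using DN x by (auto simp: N'_def X'_def split: if_splits)
  moreover have "card (insert x D) = Suc d" using \<open>x \<notin> D\<close> DN finDN by simp
  moreover have "card N' \<le> Suc d"
    using DN finDN by (auto simp: N'_def card_insert_if)
  ultimately show ?case by blast
qed

text \<open>
  Among the pairs of a vertex \<open>v\<close> and a union \<open>D\<close> of components of the tree minus \<open>v\<close>, all of whose
  vertices come after \<open>v\<close>, with at least \<open>d\<close> vertices in \<open>D\<close>, take one with \<open>D\<close> as small as possible.
  If \<open>D\<close> is a single component, then stepping from \<open>v\<close> to its root \<open>w\<close> and deleting \<open>w\<close> from \<open>D\<close>
  shows \<open>card D \<le> d\<close>. Otherwise \<open>D\<close> splits into two unions of components, both of which have fewer
  than \<open>d\<close> vertices by minimality.
\<close>
lemma closed_part_of_medium_size: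
  assumes p: "\<And>i. 0 < i \<Longrightarrow> i < t \<Longrightarrow> p i < i"
    and d: "2 \<le> d" "d < t"
  obtains v D where "v < t" "D \<subseteq> {..<t} - {v}" "d \<le> card D" "card D \<le> 2 * d - 2"
    "\<And>i j. i \<in> D \<Longrightarrow> j < t \<Longrightarrow> tree_adj p i j \<Longrightarrow> j \<in> insert v D"
proof -
  define ok where "ok v D \<longleftrightarrow> v < t \<and> D \<subseteq> {v<..<t} \<and> 
    (\<forall>i\<in>D. \<forall>j<t. tree_adj p i j \<longrightarrow> j \<in> insert v D)" for v D
  have start: "ok 0 {0<..<t}" using d by (auto simp: ok_def)
  define P where "P s \<longleftrightarrow> d \<le> s \<and> (\<exists>v D. ok v D \<and> card D = s)" for s
  have "P (t - 1)" unfolding P_def using start d by (intro conjI exI[of _ 0] exI[of _ "{0<..<t}"]) auto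
  define s where "s = (LEAST s. P s)"
  have "P s" unfolding s_def using \<open>P (t - 1)\<close> by (rule LeastI)
  have least: "card D < d" if "ok v D" "card D < s" for v D
    using not_less_Least[of "card D" P] that unfolding s_def P_def by fastforce
  from \<open>P s\<close> obtain v D where ok: "ok v D" and s: "card D = s" "d \<le> s" by (auto simp: P_def)
  have D: "v < t" "D \<subseteq> {v<..<t}" and clo: "\<And>i j. i \<in> D \<Longrightarrow> j < t \<Longrightarrow> tree_adj p i j \<Longrightarrow> j \<in> insert v D"
    using ok unfolding ok_def by blast+
  have finD: "finite D" using D finite_subset by blast
  have "D \<noteq> {}" using s d by auto
  define w where "w = Min D"
  have w: "w \<in> D" "\<And>i. i \<in> D \<Longrightarrow> w \<le> i" using finD \<open>D \<noteq> {}\<close> by (auto simp: w_def)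
  have wt: "v < w" "w < t" using w D by auto
  have pw: "p w = v"
  proof -
    have "p w < w" using p wt by auto
    moreover have "p w \<in> insert v D" using clo[of w "p w"] w wt \<open>p w < w\<close> by (auto simp: tree_adj_def)
    ultimately show ?thesis using w(2) by fastforce
  qed
  \<comment> \<open>The descendants of \<open>w\<close> within \<open>D\<close>; they form one component of the tree minus \<open>v\<close>.\<close>
  define Q where "Q = {i \<in> D. (i, w) \<in> {(i, j). i \<in> D \<and> j = p i \<and> i \<noteq> w}\<^sup>*}"
  have QD: "Q \<subseteq> D" "w \<in> Q" using w by (auto simp: Q_def)
  have up: "p i \<in> Q" if i: "i \<in> Q" "i \<noteq> w" for i
  proof -
    have "(i, w) \<in> {(i, j). i \<in> D \<and> j = p i \<and> i \<noteq> w}\<^sup>*" using i(1) by (simp add: Q_def)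
    then have *: "(p i, w) \<in> {(i, j). i \<in> D \<and> j = p i \<and> i \<noteq> w}\<^sup>*"
    proof (cases rule: converse_rtranclE)
      case base
      then show ?thesis using i(2) by simp
    qed simp
    then have "p i \<in> D"
    proof (cases rule: converse_rtranclE)
      case base
      then show ?thesis using w(1) by simp
    qed simp
    with * show ?thesis by (simp add: Q_def)
  qed
  have down: "j \<in> Q" if "p j \<in> Q" "j \<in> D" for j
    using that unfolding Q_def by (cases "j = w") (auto intro: converse_rtrancl_into_rtrancl)
  have child: "j \<in> Q" if j: "p j \<in> Q" "0 < j" "j < t" for j
  proof -
    have "p j \<in> D" "p j < j" using j QD p by auto
    then have "j \<in> insert v D" using clo[of "p j" j] j by (auto simp: tree_adj_def)
    moreover have "j \<noteq> v" using \<open>p j < j\<close> \<open>p j \<in> D\<close> D by auto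
    ultimately show ?thesis using down j by blast
  qed
  have Qadj: "j \<in> insert v Q" if i: "i \<in> Q" and j: "j < t" and a: "tree_adj p i j" for i j
  proof -
    consider "j = p i" | "0 < j" "i = p j" using a by (auto simp: tree_adj_def)
    then show ?thesis
    proof cases
      case 1
      then show ?thesis using up[OF i] pw by (cases "i = w") simp_all
    next
      case 2
      then show ?thesis using child[of j] i j by simp
    qed
  qed
  have vD: "v \<notin> D" using D by auto
  have "card D \<le> 2 * d - 2"
  proof (cases "Q = D")
    case True
    have "ok w (D - {w})"
      unfolding ok_def
    proof (intro conjI ballI allI impI)
      show "w < t" by fact
      show "D - {w} \<subseteq> {w<..<t}" using w D by fastforce
      fix i j assume i: "i \<in> D - {w}" and j: "j < t" and a: "tree_adj p i j"
      have "j \<noteq> v"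
      proof
        assume "j = v"
        moreover have "i > v" using i D by auto
        ultimately have "p i = v" using a p[of v] D by (auto simp: tree_adj_def)
        then show False using up[of i] i True vD by auto
      qed
      then show "j \<in> insert w (D - {w})" using clo[of i j] i j a by auto
    qed
    then have "card (D - {w}) < d" using least s finD w 
      by (meson card_Diff1_less)
    then show ?thesis using finD w d by auto
  next
    case False
    then have lt: "Q \<subset> D" using QD by auto
    have "ok v Q" using Qadj QD D unfolding ok_def by blast
    moreover have "card Q < s" using lt finD s psubset_card_mono by blast
    ultimately have 1: "card Q < d" using least by blast
    have "ok v (D - Q)" unfolding ok_def
    proof (intro conjI ballI allI impI)
      fix i j assume i: "i \<in> D - Q" and j: "j < t" and a: "tree_adj p i j"
      have "j \<notin> Q"
      proof
        assume "j \<in> Q"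
        then have "i \<in> insert v Q" using Qadj[of j i] a i D tree_adj_sym by fastforce
        then show False using i vD by auto
      qed
      then show "j \<in> insert v (D - Q)" using clo[of i j] i j a by auto
    qed (use D in auto)
    moreover have "card (D - Q) < s" using QD finD s by (auto intro!: psubset_card_mono)
    ultimately have 2: "card (D - Q) < d" using least by blast
    have "card D = card Q + card (D - Q)" using QD finD
      by (metis card_Diff_subset card_mono finite_subset le_add_diff_inverse)
    then show ?thesis using 1 2 by linarith
  qed
  moreover have "D \<subseteq> {..<t} - {v}" using D by fastforce
  ultimately show ?thesis using that[of v D] D(1) clo s by blast
qed

section \<open>Clusters of large cliques\<close>

lemma four_mult_le_square_add_four:
  fixes d :: nat
  assumes "2 \<le> d"
  shows "4 * d \<le> d * d + 4"
proof -
  obtain e where "d = e + 2" using assms by (metis le_add_diff_inverse2)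
  then show ?thesis by (simp add: algebra_simps)
qed

text \<open>
  The tree has \<open>t = k + d\<close> vertices, and the inequality between \<open>d\<close> and \<open>k\<close> is \<open>t \<ge> d\<^sup>2 - d + 3\<close>
  written without subtraction.
\<close>
locale tree_free_graph =
  fixes G :: "'a graph" and k d :: nat and p :: "nat \<Rightarrow> nat"
  assumes simple: "simple_graph G"
    and parent: "\<And>i. 0 < i \<Longrightarrow> i < k + d \<Longrightarrow> p i < i"
    and d: "2 \<le> d"
    and k: "d * d + 3 \<le> k + 2 * d"
    and free: "\<not> embeds (k + d) p G"
begin

definition kcliques :: "'a set set" where
  "kcliques = {C. clique G C \<and> card C = k}"

lemma finite_verts: "finite (verts G)"
  using simple by (simp add: simple_graph_def)

lemma two_d_le: "2 * d \<le> k + 1"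
  using four_mult_le_square_add_four[OF d] k by linarith

lemma kclique_facts:
  assumes "A \<in> kcliques"
  shows "finite A" "card A = k" "clique G A" "A \<subseteq> verts G" "A \<noteq> {}"
proof -
  show "A \<subseteq> verts G" "card A = k" "clique G A" using assms by (auto simp: kcliques_def clique_def)
  then show "finite A" using finite_verts finite_subset by blast
  have "k > 0" using two_d_le d by linarith
  then show "A \<noteq> {}" using \<open>card A = k\<close> by auto
qed

lemma finite_kcliques: "finite kcliques"
  by (rule finite_subset[of _ "Pow (verts G)"]) (auto simp: kclique_facts(4) finite_verts dest: kclique_facts(4))

text \<open>
  Otherwise the last vertex of the tree, a leaf, can go to \<open>z\<close>, its parent to \<open>a\<close>, and the remaining
  vertices into the clique.
\<close>
lemma no_edge_leaves_big_clique:
  assumes A: "clique G A" "card A = k + d - 1" and a: "a \<in> A" and z: "z \<notin> A"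
  shows "{z, a} \<notin> edges G"
proof
  assume e: "{z, a} \<in> edges G"
  let ?t = "k + d"
  have t: "?t \<ge> 4" using two_d_le d by linarith
  have finA: "finite A" using A finite_verts finite_subset by (auto simp: clique_def)
  have zV: "z \<in> verts G" using e simple by (auto simp: simple_graph_def)
  have pt: "p (?t - 1) < ?t - 1" using parent[of "?t - 1"] t by simp
  have "embeds ?t p G"
  proof (rule embeds_three_parts[where D = "{?t - 1}" and N = "{p (?t - 1)}" and
        R = "{..<?t} - {?t - 1, p (?t - 1)}" and X = "{z}" and Y = "{a}" and Z = "A - {a}"])
    show "{..<?t} = {?t - 1} \<union> {p (?t - 1)} \<union> ({..<?t} - {?t - 1, p (?t - 1)})"
      using t pt by auto
    show "\<not> tree_adj p i j" if "i \<in> {?t - 1}" "j \<in> {..<?t} - {?t - 1, p (?t - 1)}" for i j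
      using that parent[of j] by (auto simp: tree_adj_def)
    have "card ({..<?t} - {?t - 1, p (?t - 1)}) = ?t - 2"
      using t pt by (subst card_Diff_subset) auto
    also have "\<dots> = card (A - {a})" using a A finA by simp
    finally show "card ({..<?t} - {?t - 1, p (?t - 1)}) \<le> card (A - {a})" by simp
    show "clique G ({a} \<union> (A - {a}))" using A(1) a by (simp add: insert_absorb)
    show "joined G {z} {a}" using e by (simp add: joined_def)
    show "clique G {z} \<or> (\<forall>i\<in>{?t - 1}. \<forall>j\<in>{?t - 1}. \<not> tree_adj p i j)"
      using zV by (simp add: clique_def)
  qed (use parent pt z a zV finA in auto)
  then show False using free by blast
qed

text \<open>
  Place a cut vertex of the tree at a common vertex \<open>z\<close> of the two cliques and a union of its
  branches with between \<open>d\<close> and \<open>2 * d - 2\<close> vertices into \<open>B - {z}\<close>, using vertices outside \<open>A\<close>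
  as far as possible. What remains of \<open>A\<close> has room for the other branches.
\<close>
lemma card_union_meeting_kcliques:
  assumes A: "A \<in> kcliques" and B: "B \<in> kcliques" and AB: "A \<inter> B \<noteq> {}"
  shows "card (A \<union> B) < k + d"
proof (rule ccontr)
  assume "\<not> card (A \<union> B) < k + d"
  then have big: "k + d \<le> card (A \<union> B)" by simp
  obtain z where z: "z \<in> A" "z \<in> B" using AB by blast
  note fA = kclique_facts[OF A] and fB = kclique_facts[OF B]
  let ?t = "k + d"
  have "d < ?t" using two_d_le d by linarith
  then obtain v D where vD: "v < ?t" "D \<subseteq> {..<?t} - {v}" "d \<le> card D" "card D \<le> 2 * d - 2"
    "\<And>i j. i \<in> D \<Longrightarrow> j < ?t \<Longrightarrow> tree_adj p i j \<Longrightarrow> j \<in> insert v D"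
    using closed_part_of_medium_size[OF parent d] by metis
  have finD: "finite D" using vD(2) finite_subset by blast
  let ?R = "{..<?t} - {v} - D"
  have cR: "card ?R = ?t - 1 - card D"
    using vD(1,2) finD by (simp add: card_Diff_subset)
  have cAz: "card (A - {z}) = k - 1" and cBz: "card (B - {z}) = k - 1"
    using z fA fB by simp_all
  have Dk: "card D \<le> k - 1" using vD(4) two_d_le by linarith
  have finAB: "finite (A \<union> B)" using fA fB by simp
  have "A \<union> B = A \<union> (B - A)" by blast
  then have cBA: "card (A \<union> B) = k + card (B - A)" using fA fB
    by (metis Diff_disjoint card_Un_disjoint finite_Diff)
  \<comment> \<open>Either \<open>X\<close> lies in \<open>B - A\<close> and takes nothing from \<open>A\<close>, or it contains \<open>B - A\<close>, so that \<open>X\<close> and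
    the rest of \<open>A\<close> exhaust \<open>A \<union> B\<close> apart from \<open>z\<close>.\<close>
  obtain X where X: "X \<subseteq> B - {z}" "card X = card D" "card ?R \<le> card (A - {z} - X)"
  proof (cases "card D \<le> card (B - A)")
    case True
    then obtain X where X: "X \<subseteq> B - A" "card X = card D" by (meson obtain_subset_with_card_n)
    then have "A - {z} - X = A - {z}" by blast
    then have "card ?R \<le> card (A - {z} - X)" using cAz cR vD(3) two_d_le d by simp
    moreover have "X \<subseteq> B - {z}" using X z by blast
    ultimately show ?thesis using that X by blast
  next
    case False
    have "B - A \<subseteq> B - {z}" using z by blast
    then obtain X where X: "B - A \<subseteq> X" "X \<subseteq> B - {z}" "card X = card D"
      using exists_subset_between[of "B - A" "card D" "B - {z}"] False Dk cBz fB by auto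
    have "A - {z} - X = (A \<union> B) - insert z X" using X by blast
    moreover have "card (insert z X) = Suc (card D)" using X fB finite_subset[OF X(2)] by (auto simp: card_insert_if)
    moreover have "insert z X \<subseteq> A \<union> B" using X z by blast
    ultimately have "card (A - {z} - X) = card (A \<union> B) - Suc (card D)"
      using finAB by (metis card_Diff_subset finite_subset)
    then have "card ?R \<le> card (A - {z} - X)" using cR big by linarith
    then show ?thesis using that X by blast
  qed
  have "embeds ?t p G"
  proof (rule embeds_three_parts[where D = D and N = "{v}" and R = ?R and X = X and Y = "{z}" and Z = "A - {z} - X"])
    show "\<not> tree_adj p i j" if "i \<in> D" "j \<in> ?R" for i j
      using vD(5)[of i j] that by blast
    show "clique G ({z} \<union> (A - {z} - X))" by (rule clique_subset[OF fA(3)]) (use z in blast)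
    have "joined G (B - {z}) {z}" using fB(3) z unfolding clique_def joined_def by auto
    then show "joined G X {z}" using X(1) by (auto simp: joined_def)
    show "clique G X \<or> (\<forall>i\<in>D. \<forall>j\<in>D. \<not> tree_adj p i j)"
      using clique_subset[OF fB(3)] X(1) by blast
    show "X \<subseteq> verts G" using X(1) fB(4) by blast
    show "finite X" using X(1) fB(1) by (meson finite_Diff finite_subset)
  qed (use parent vD X fA in auto)
  then show False using free by blast
qed

lemma card_diff_meeting_kcliques:
  assumes A: "A \<in> kcliques" and B: "B \<in> kcliques" and AB: "A \<inter> B \<noteq> {}"
  shows "card (A - B) < d"
proof -
  note fA = kclique_facts[OF A] and fB = kclique_facts[OF B]
  have "A \<union> B = B \<union> (A - B)" by blast
  then have "card (A \<union> B) = k + card (A - B)" using fA fB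
    by (metis Diff_disjoint card_Un_disjoint finite_Diff)
  then show ?thesis using card_union_meeting_kcliques[OF assms] by linarith
qed

lemma meeting_trans:
  assumes A: "A \<in> kcliques" and B: "B \<in> kcliques" and C: "C \<in> kcliques"
    and AB: "A \<inter> B \<noteq> {}" and BC: "B \<inter> C \<noteq> {}"
  shows "A \<inter> C \<noteq> {}"
proof
  assume "A \<inter> C = {}"
  then have "B \<subseteq> (B - A) \<union> (B - C)" by blast
  then have "card B \<le> card (B - A) + card (B - C)"
    using kclique_facts[OF B] by (meson card_Un_le card_mono finite_Diff finite_UnI le_trans)
  moreover have "card (B - A) < d" "card (B - C) < d"
    using card_diff_meeting_kcliques A B C AB BC by (metis Int_commute)+
  ultimately show False using kclique_facts(2)[OF B] two_d_le by linarith
qed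

text \<open>
  Were there \<open>d\<close> such vertices outside \<open>A\<close>, they could take \<open>d\<close> independent vertices of the tree,
  \<open>I\<close> could take the at most \<open>d\<close> neighbours of these, and \<open>A\<close> would have exactly enough room for the
  rest.
\<close>
lemma few_vertices_joined_to_large_core:
  assumes A: "A \<in> kcliques" and I: "I \<subseteq> A" "d \<le> card I"
    and W: "W \<subseteq> verts G" "W \<inter> A = {}" "finite W" "joined G W I"
  shows "card W < d"
proof (rule ccontr)
  assume "\<not> card W < d"
  then have "d \<le> card W" by simp
  let ?t = "k + d"
  note fA = kclique_facts[OF A]
  obtain D N where DN: "D \<subseteq> {..<?t}" "N \<subseteq> {..<?t}" "D \<inter> N = {}" "card D = d" "card N \<le> d"
      "\<forall>i\<in>D. \<forall>j\<in>{..<?t}. tree_adj p i j \<longrightarrow> j \<in> N"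
    using small_neighbourhood[OF parent, of "k + d" "{..<?t}" d] two_d_le d by auto
  have fin: "finite D" "finite N" using DN finite_subset by blast+
  obtain Y where Y: "Y \<subseteq> I" "card Y = card N" and finY: "finite Y"
    by (rule obtain_subset_with_card_n[OF order_trans[OF DN(5) I(2)]])
  let ?R = "{..<?t} - (D \<union> N)"
  have "card (D \<union> N) = d + card N" using DN fin by (simp add: card_Un_disjoint)
  then have "card ?R = k - card N"
    using DN fin by (simp add: card_Diff_subset)
  moreover have "card (A - Y) = k - card N" using Y I fA finY by (simp add: card_Diff_subset)
  ultimately have cR: "card ?R \<le> card (A - Y)" by simp
  have "embeds ?t p G"
  proof (rule embeds_three_parts[where D = D and N = N and R = ?R and X = W and Y = Y and Z = "A - Y"])
    show "\<not> tree_adj p i j" if "i \<in> D" "j \<in> ?R" for i j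
      using DN(6) that by blast
    show "clique G (Y \<union> (A - Y))" by (rule clique_subset[OF fA(3)]) (use Y I in blast)
    show "joined G W Y" using W(4) Y(1) by (auto simp: joined_def)
    show "clique G W \<or> (\<forall>i\<in>D. \<forall>j\<in>D. \<not> tree_adj p i j)"
      using DN by blast
    show "W \<inter> Y = {}" using W(2) Y I by blast
    show "W \<inter> (A - Y) = {}" using W(2) by blast
    show "card D \<le> card W" using DN(4) \<open>d \<le> card W\<close> by simp
  qed (use parent DN Y cR W fA finY in auto)
  then show False using free by blast
qed

text \<open>
  With \<open>d = j + 1 + c\<close> the claim reduces to \<open>(j - 1) * (j - 2) + j * c + c\<^sup>2 \<ge> 0\<close>. For \<open>d = 2\<close>, \<open>j = 1\<close>
  and for \<open>d = 3\<close>, \<open>j = 2\<close> there is equality at the smallest admissible \<open>k\<close>.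
\<close>
lemma core_size_bound:
  assumes "1 \<le> j" "j < d"
  shows "d + j + (d - j) * (j - 1) \<le> k"
proof -
  obtain i where i: "j = Suc i" using assms(1) by (cases j) auto
  obtain c where c: "d = Suc j + c" using assms(2) by (metis less_iff_Suc_add add_Suc)
  have "i \<le> i * i" by (cases i) auto
  moreover have "c * c + i * i + 3 + 2 * c + 2 * i + 2 * (c * i) \<le> k"
    using k unfolding c i by (simp add: algebra_simps)
  moreover have "d + j + (d - j) * (j - 1) = 3 + 3 * i + c + c * i"
    unfolding c i by (simp add: algebra_simps)
  ultimately show ?thesis by linarith
qed

text \<open>
  Otherwise the family provides \<open>d\<close> vertices outside a member \<open>A0\<close> that are all joined to a common
  set \<open>I \<subseteq> A0\<close> of at least \<open>d\<close> vertices. The point is to lose little when intersecting: a member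
  \<open>B\<close> with a vertex outside \<open>A0 \<union> A1\<close> misses at most \<open>j - 1\<close> vertices of \<open>A0 \<inter> A1\<close>, because that
  vertex is counted both in \<open>B - A0\<close> and in \<open>B - A1\<close>, which have at most \<open>j\<close> elements each.
\<close>
lemma card_Union_pairwise_meeting_kcliques:
  assumes sub: "\<A> \<subseteq> kcliques" and ne: "\<A> \<noteq> {}"
    and meet: "\<And>A B. A \<in> \<A> \<Longrightarrow> B \<in> \<A> \<Longrightarrow> A \<inter> B \<noteq> {}"
  shows "card (\<Union>\<A>) < k + d"
proof (rule ccontr)
  assume "\<not> card (\<Union>\<A>) < k + d"
  then have big: "k + d \<le> card (\<Union>\<A>)" by simp
  have fin\<A>: "finite \<A>" using sub finite_kcliques finite_subset by blast
  note facts = kclique_facts[OF subsetD[OF sub]]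
  have finU: "finite (\<Union>\<A>)" using fin\<A> facts by blast
  define S where "S = (\<lambda>(A, B). card (A - B)) ` (\<A> \<times> \<A>)"
  have S: "finite S" "S \<noteq> {}" using fin\<A> ne by (auto simp: S_def)
  define j where "j = Max S"
  have "j \<in> S" using S by (simp add: j_def)
  then obtain A0 A1 where A01: "A0 \<in> \<A>" "A1 \<in> \<A>" and j: "j = card (A0 - A1)" by (auto simp: S_def)
  have max: "card (A - B) \<le> j" if "A \<in> \<A>" "B \<in> \<A>" for A B
  proof -
    have "card (A - B) \<in> S" using that by (force simp: S_def)
    then show ?thesis using S by (simp add: j_def)
  qed
  have jd: "j < d" unfolding j
    by (rule card_diff_meeting_kcliques[OF subsetD[OF sub A01(1)] subsetD[OF sub A01(2)] meet[OF A01]])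
  note f0 = facts[OF A01(1)] and f1 = facts[OF A01(2)]
  have cC: "card (A0 \<inter> A1) = k - j"
    using card_Int_Diff[OF f0(1), of A1] f0(2) j by linarith
  have jk: "j \<le> k" using jd two_d_le d by linarith
  have c10: "card (A1 - A0) = j"
    using card_Int_Diff[OF f1(1), of A0] f1(2) cC jk unfolding Int_commute[of A1] by linarith
  have "A0 \<union> A1 = A0 \<union> (A1 - A0)" by blast
  then have cU: "card (A0 \<union> A1) = k + j" using f0 f1 c10
    by (metis Diff_disjoint card_Un_disjoint finite_Diff)
  have "card (\<Union>\<A> - (A0 \<union> A1)) = card (\<Union>\<A>) - (k + j)"
    using cU A01 f0 f1 by (subst card_Diff_subset) auto
  then have "d - j \<le> card (\<Union>\<A> - (A0 \<union> A1))" using big by linarith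
  then obtain W where W: "W \<subseteq> \<Union>\<A> - (A0 \<union> A1)" "card W = d - j" "finite W"
    by (rule obtain_subset_with_card_n)
  have "\<forall>w\<in>W. \<exists>B. B \<in> \<A> \<and> w \<in> B" using W by blast
  then obtain B where B: "\<And>w. w \<in> W \<Longrightarrow> B w \<in> \<A> \<and> w \<in> B w" by metis
  have loss: "1 \<le> j \<and> card ((A0 \<inter> A1) - B w) \<le> j - 1" if w: "w \<in> W" for w
  proof -
    have Bw: "B w \<in> \<A>" "w \<in> B w" using B w by auto
    note fB = facts[OF Bw(1)]
    let ?P = "B w - A0" and ?Q = "B w - A1"
    have "w \<notin> A0 \<union> A1" using W(1) w by blast
    then have wPQ: "w \<in> ?P" "w \<in> ?Q" using Bw(2) by simp_all
    have "card (?P \<union> ?Q) + card (?P \<inter> ?Q) = card ?P + card ?Q"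
      using card_Un_Int[of ?P ?Q] fB(1) by (metis finite_Diff)
    moreover have "card (?P \<inter> ?Q) \<ge> 1"
    proof -
      have "?P \<inter> ?Q \<noteq> {}" "finite (?P \<inter> ?Q)" using wPQ fB(1) by auto
      then show ?thesis by (simp add: Suc_le_eq card_gt_0_iff)
    qed
    moreover have cP: "card ?P \<le> j" "card ?Q \<le> j" using max[OF Bw(1) A01(1)] max[OF Bw(1) A01(2)] .
    ultimately have PQ: "card (?P \<union> ?Q) + 1 \<le> 2 * j" by linarith
    have "B w = (B w \<inter> (A0 \<inter> A1)) \<union> (?P \<union> ?Q)" by blast
    then have "k \<le> card (B w \<inter> (A0 \<inter> A1)) + card (?P \<union> ?Q)"
      using fB(2) card_Un_le[of "B w \<inter> (A0 \<inter> A1)" "?P \<union> ?Q"] by simp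
    moreover have "card ((A0 \<inter> A1) - B w) = (k - j) - card (B w \<inter> (A0 \<inter> A1))"
      using card_Diff_subset_Int[of "A0 \<inter> A1" "B w"] cC f0(1)
      by (simp add: Int_commute[of "B w"])
    ultimately show ?thesis using PQ jk by linarith
  qed
  have "W \<noteq> {}" using W jd by auto
  then have j1: "1 \<le> j" using loss by blast
  \<comment> \<open>The common intersection of all chosen members, written as what is left of \<open>A0 \<inter> A1\<close>.\<close>
  define I where "I = (A0 \<inter> A1) - (\<Union>w\<in>W. (A0 \<inter> A1) - B w)"
  have "card (\<Union>w\<in>W. (A0 \<inter> A1) - B w) \<le> (\<Sum>w\<in>W. card ((A0 \<inter> A1) - B w))"
    by (rule card_UN_le[OF W(3)])
  also have "\<dots> \<le> (\<Sum>w\<in>W. j - 1)" using loss by (intro sum_mono) blast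
  also have "\<dots> = (d - j) * (j - 1)" using W by simp
  finally have "card (A0 \<inter> A1) - (d - j) * (j - 1) \<le> card I"
    unfolding I_def using f0 W(3) by (subst card_Diff_subset) auto
  then have "d \<le> card I" using core_size_bound[OF j1 jd] cC by linarith
  moreover have "I \<subseteq> A0" by (auto simp: I_def)
  moreover have "joined G (W \<union> (A1 - A0)) I"
    unfolding joined_def
  proof (intro ballI)
    fix x y assume x: "x \<in> W \<union> (A1 - A0)" and y: "y \<in> I"
    have yC: "y \<in> A0" "y \<in> A1" using y by (auto simp: I_def)
    show "{x, y} \<in> edges G"
    proof (cases "x \<in> W")
      case True
      then have "y \<in> B x" "x \<in> B x" "x \<noteq> y" using y B W yC by (auto simp: I_def)
      then show ?thesis using facts(3)[of "B x"] B True unfolding clique_def by blast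
    next
      case False
      then have "x \<in> A1" "x \<noteq> y" using x yC by auto
      then show ?thesis using f1(3) yC unfolding clique_def by blast
    qed
  qed
  moreover have "W \<union> (A1 - A0) \<subseteq> verts G" using W facts(4) f1(4) by blast
  moreover have "(W \<union> (A1 - A0)) \<inter> A0 = {}" using W by blast
  moreover have "finite (W \<union> (A1 - A0))" using W f1 by simp
  ultimately have "card (W \<union> (A1 - A0)) < d"
    using few_vertices_joined_to_large_core A01 sub by blast
  moreover have "card (W \<union> (A1 - A0)) = (d - j) + j"
    using W f1 c10 by (subst card_Un_disjoint) auto
  ultimately show False using jd by simp
qed

text \<open>
  The clusters are the unions of the classes of the relation of meeting.
\<close>
lemma kclique_clusters:
  obtains \<U> where "finite \<U>" "pairwise disjnt \<U>" "\<And>X. X \<in> \<U> \<Longrightarrow> X \<subseteq> verts G \<and> k \<le> card X \<and> card X < k + d"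
    "\<And>A. A \<in> kcliques \<Longrightarrow> \<exists>X\<in>\<U>. A \<subseteq> X"
proof -
  define U where "U A = \<Union>{B \<in> kcliques. A \<inter> B \<noteq> {}}" for A
  have self: "A \<subseteq> U A" if "A \<in> kcliques" for A
    using that kclique_facts(5)[OF that] by (auto simp: U_def)
  have same: "U A = U B" if "A \<in> kcliques" "B \<in> kcliques" "A \<inter> B \<noteq> {}" for A B
    unfolding U_def using that meeting_trans by (metis (no_types, lifting) Int_commute)
  have disj: "U A = U B" if A: "A \<in> kcliques" and B: "B \<in> kcliques" and ne: "U A \<inter> U B \<noteq> {}" for A B
  proof -
    obtain A' B' where "A' \<in> kcliques" "B' \<in> kcliques" "A \<inter> A' \<noteq> {}" "B \<inter> B' \<noteq> {}" "A' \<inter> B' \<noteq> {}"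
      using ne unfolding U_def by blast
    then show ?thesis using same A B by metis
  qed
  have size: "U A \<subseteq> verts G \<and> k \<le> card (U A) \<and> card (U A) < k + d" if A: "A \<in> kcliques" for A
  proof (intro conjI)
    show V: "U A \<subseteq> verts G" unfolding U_def using kclique_facts(4) by blast
    then show "k \<le> card (U A)"
      using self[OF A] kclique_facts(2)[OF A] finite_verts by (metis card_mono finite_subset)
    show "card (U A) < k + d" unfolding U_def
    proof (rule card_Union_pairwise_meeting_kcliques)
      show "{B \<in> kcliques. A \<inter> B \<noteq> {}} \<noteq> {}" using A kclique_facts(5)[OF A] by auto
      show "B \<inter> C \<noteq> {}" if "B \<in> {B \<in> kcliques. A \<inter> B \<noteq> {}}" "C \<in> {B \<in> kcliques. A \<inter> B \<noteq> {}}" for B C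
        using that A meeting_trans[of B A C] by (simp add: Int_commute)
    qed simp
  qed
  show ?thesis
  proof (rule that[of "U ` kcliques"])
    show "finite (U ` kcliques)" using finite_kcliques by simp
    show "pairwise disjnt (U ` kcliques)" using disj by (auto simp: pairwise_def disjnt_def)
    show "X \<subseteq> verts G \<and> k \<le> card X \<and> card X < k + d" if "X \<in> U ` kcliques" for X
      using that size by blast
    show "\<exists>X\<in>U ` kcliques. A \<subseteq> X" if "A \<in> kcliques" for A using self that by blast
  qed
qed

end

section \<open>Packing sizes into bins: a convexity bound\<close>

lemma choose_strict_mono:
  assumes "x < y" "1 \<le> k" "k \<le> y"
  shows "x choose k < y choose k"
proof -
  obtain y' k' where y: "y = Suc y'" and k: "k = Suc k'" using assms by (cases y; cases k) auto
  have "x choose k \<le> y' choose k" using assms(1) y by (intro binomial_right_mono) simp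
  moreover have "y' choose k' > 0" using assms(3) y k by simp
  moreover have "y choose k = (y' choose k') + (y' choose k)" by (simp add: y k)
  ultimately show ?thesis by linarith
qed

text \<open>
  Convexity: raising the larger of two numbers by \<open>e\<close> gains at least as much as raising the smaller
  one.
\<close>
lemma choose_exchange:
  assumes "s \<le> u"
  shows "(s + e choose Suc k) + (u choose Suc k) \<le> (u + e choose Suc k) + (s choose Suc k)"
proof (induction e)
  case (Suc e)
  have "s + e choose k \<le> u + e choose k" using assms by (intro binomial_right_mono) simp
  then show ?case using Suc by simp
qed simp

lemma choose_exchange_strict:
  assumes "s < u" "0 < e" "2 \<le> k" "k \<le> u"
  shows "(s + e choose k) + (u choose k) < (u + e choose k) + (s choose k)"
proof -
  obtain k' where k: "k = Suc k'" using assms(3) by (cases k) auto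
  obtain e' where e: "e = Suc e'" using assms(2) by (cases e) auto
  have "s + e' choose k' < u + e' choose k'"
    using assms k by (intro choose_strict_mono) auto
  moreover have "(s + e' choose k) + (u choose k) \<le> (u + e' choose k) + (s choose k)"
    unfolding k using assms(1) by (intro choose_exchange) simp
  ultimately show ?thesis by (simp add: k e)
qed

text \<open>
  The number of \<open>k\<close>-cliques in disjoint complete graphs on \<open>n\<close> vertices, all of them of size \<open>m\<close>
  except for one that takes the remainder.
\<close>
definition packing_value :: "nat \<Rightarrow> nat \<Rightarrow> nat \<Rightarrow> nat" where
  "packing_value m k n = (n div m) * (m choose k) + (n mod m choose k)"

lemma packing_value_eq:
  assumes "r < m"
  shows "packing_value m k (q * m + r) = q * (m choose k) + (r choose k)"
  using assms by (simp add: packing_value_def)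

text \<open>
  Merge the new part \<open>u\<close> with the remainder \<open>r = a mod m\<close>. If they do not fill a part of size \<open>m\<close>,
  this compares \<open>r\<close>, \<open>u\<close> with \<open>r + u\<close>, \<open>0\<close>. Otherwise it compares them with \<open>m\<close>, \<open>r + u - m\<close>.
  Both are exchanges, and for \<open>k \<le> u\<close> they are strict unless \<open>u = m\<close> or \<open>r = 0\<close>.
\<close>
lemma packing_value_add:
  assumes "0 < m" "0 < k" "u \<le> m"
  shows "packing_value m k a + (u choose k) \<le> packing_value m k (a + u)"
    and "2 \<le> k \<Longrightarrow> k \<le> u \<Longrightarrow> u < m \<Longrightarrow> a mod m \<noteq> 0 \<Longrightarrow>
      packing_value m k a + (u choose k) < packing_value m k (a + u)"
proof -
  define q r where "q = a div m" and "r = a mod m"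
  have a: "a = q * m + r" and r: "r < m" using assms by (auto simp: q_def r_def)
  obtain k' where k': "k = Suc k'" using assms(2) by (cases k) auto
  have Fa: "packing_value m k a = q * (m choose k) + (r choose k)"
    unfolding a by (rule packing_value_eq[OF r])
  have "packing_value m k a + (u choose k) \<le> packing_value m k (a + u) \<and>
    (2 \<le> k \<longrightarrow> k \<le> u \<longrightarrow> u < m \<longrightarrow> r \<noteq> 0 \<longrightarrow>
      packing_value m k a + (u choose k) < packing_value m k (a + u))"
  proof (cases "r + u < m")
    case True
    have "packing_value m k (a + u) = q * (m choose k) + (r + u choose k)"
      using packing_value_eq[OF True, of k q] unfolding a by (simp add: add.assoc)
    moreover have "(r choose k) + (u choose k) \<le> (r + u choose k)"
      using choose_exchange[of 0 u r k'] unfolding k' by (simp add: add.commute)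
    moreover have "(r choose k) + (u choose k) < (r + u choose k)" if "2 \<le> k" "k \<le> u" "r \<noteq> 0"
      using choose_exchange_strict[of 0 u r k] that k' by (simp add: add.commute)
    ultimately show ?thesis using Fa by auto
  next
    case False
    define s where "s = r + u - m"
    have s: "s < m" "r = s + (m - u)" "s \<le> u" using False r assms(3) by (auto simp: s_def)
    have "a + u = (q + 1) * m + s" using False assms(3) unfolding a s_def by simp
    then have "packing_value m k (a + u) = q * (m choose k) + (m choose k) + (s choose k)"
      using packing_value_eq[OF s(1), of k "q + 1"] by simp
    moreover have "(r choose k) + (u choose k) \<le> (m choose k) + (s choose k)"
      using choose_exchange[OF s(3), of "m - u" k'] s(2) assms(3) unfolding k' by simp
    moreover have "(r choose k) + (u choose k) < (m choose k) + (s choose k)"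
      if "2 \<le> k" "k \<le> u" "u < m"
      using choose_exchange_strict[of s u "m - u" k] s(2) r that assms(3) by simp
    ultimately show ?thesis using Fa by auto
  qed
  then show "packing_value m k a + (u choose k) \<le> packing_value m k (a + u)"
    and "2 \<le> k \<Longrightarrow> k \<le> u \<Longrightarrow> u < m \<Longrightarrow> a mod m \<noteq> 0 \<Longrightarrow>
      packing_value m k a + (u choose k) < packing_value m k (a + u)"
    unfolding r_def by blast+
qed

lemma packing_value_mono:
  assumes "0 < m" "0 < k" "a \<le> b"
  shows "packing_value m k a \<le> packing_value m k b"
  using assms(3)
proof (induction b rule: dec_induct)
  case (step b)
  have "packing_value m k b \<le> packing_value m k (b + 1)"
    using packing_value_add(1)[of m k 1 b] assms by simp
  then show ?case using step by simp
qed simp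

lemma packing_value_add_sum:
  assumes "0 < m" "0 < k" "finite I" "\<And>i. i \<in> I \<Longrightarrow> u i \<le> m"
  shows "packing_value m k a + (\<Sum>i\<in>I. u i choose k) \<le> packing_value m k (a + (\<Sum>i\<in>I. u i))"
  using assms(3,4)
proof (induction I)
  case (insert x I)
  have "packing_value m k (a + (\<Sum>i\<in>I. u i)) + (u x choose k) \<le> packing_value m k (a + (\<Sum>i\<in>I. u i) + u x)"
    using insert.prems[of x] by (intro packing_value_add(1) assms(1,2)) simp
  moreover have "packing_value m k a + (\<Sum>i\<in>I. u i choose k) \<le> packing_value m k (a + (\<Sum>i\<in>I. u i))"
    by (rule insert.IH) (simp add: insert.prems)
  ultimately show ?case using insert.hyps by (simp add: ac_simps)
qed simp

text \<open>
  Two parts smaller than \<open>m\<close> could be merged with a strict gain, so at most one part is smaller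
  than \<open>m\<close>; the value then determines the number of parts of size \<open>m\<close> and the size of the exceptional
  one.
\<close>
lemma packing_sum_extremal:
  assumes k: "2 \<le> k" and fin: "finite I" and u: "\<And>i. i \<in> I \<Longrightarrow> k \<le> u i \<and> u i \<le> m"
    and \<beta>: "\<beta> < m" and sum: "(\<Sum>i\<in>I. u i) \<le> \<alpha> * m + \<beta>"
    and val: "\<alpha> * (m choose k) + (\<beta> choose k) \<le> (\<Sum>i\<in>I. u i choose k)" and km: "k \<le> m"
  shows "card {i \<in> I. u i = m} = \<alpha>" and "k \<le> \<beta> \<Longrightarrow> \<exists>i\<in>I. u i = \<beta>"
proof -
  have pos: "0 < m" "0 < k" using k km by auto
  have F: "packing_value m k (\<alpha> * m + \<beta>) = \<alpha> * (m choose k) + (\<beta> choose k)"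
    by (rule packing_value_eq[OF \<beta>])
  have F1: "packing_value m k x = x choose k" if "x < m" for x
    using packing_value_eq[OF that, of k 0] pos by simp
  have one: "c = c'" if c: "c \<in> I" "u c < m" "c' \<in> I" "u c' < m" for c c'
  proof (rule ccontr)
    assume ne: "c \<noteq> c'"
    let ?J = "I - {c, c'}"
    have split: "sum f I = f c' + f c + sum f ?J" for f :: "_ \<Rightarrow> nat"
    proof -
      have "I = insert c' (insert c ?J)" using c by blast
      then have "sum f I = sum f (insert c' (insert c ?J))" by simp
      also have "\<dots> = f c' + (f c + sum f ?J)" using ne fin by simp
      finally show ?thesis by simp
    qed
    have "u c' mod m \<noteq> 0" using u[OF c(3)] c(4) k by simp
    then have "(u c' choose k) + (u c choose k) < packing_value m k (u c' + u c)"
      using packing_value_add(2)[of m k "u c" "u c'"] pos k u[OF c(1)] c F1[of "u c'"] by simp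
    moreover have "packing_value m k (u c' + u c) + (\<Sum>i\<in>?J. u i choose k)
        \<le> packing_value m k (u c' + u c + (\<Sum>i\<in>?J. u i))"
      using pos fin u by (intro packing_value_add_sum) auto
    ultimately have "(\<Sum>i\<in>I. u i choose k) < packing_value m k (\<Sum>i\<in>I. u i)"
      unfolding split[of "\<lambda>i. u i choose k"] split[of u] by linarith
    also have "\<dots> \<le> packing_value m k (\<alpha> * m + \<beta>)" by (rule packing_value_mono[OF pos sum])
    finally show False using val F by simp
  qed
  let ?B = "{i \<in> I. u i = m}" and ?S = "{i \<in> I. u i \<noteq> m}"
  have split: "sum f I = sum f ?B + sum f ?S" for f :: "_ \<Rightarrow> nat"
  proof -
    have "I = ?B \<union> ?S" by blast
    then have "sum f I = sum f (?B \<union> ?S)" by simp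
    also have "\<dots> = sum f ?B + sum f ?S" using fin by (intro sum.union_disjoint) auto
    finally show ?thesis .
  qed
  have B: "(\<Sum>i\<in>?B. u i) = card ?B * m" "(\<Sum>i\<in>?B. u i choose k) = card ?B * (m choose k)" by simp_all
  have le: "card ?B * m + (\<Sum>i\<in>?S. u i) \<le> \<alpha> * m + \<beta>" using sum split[of u] B by simp
  have ge: "\<alpha> * (m choose k) + (\<beta> choose k) \<le> card ?B * (m choose k) + (\<Sum>i\<in>?S. u i choose k)"
    using val split[of "\<lambda>i. u i choose k"] B by simp
  have "card ?B * m < (\<alpha> + 1) * m" using le \<beta> by simp
  then have q: "card ?B \<le> \<alpha>" by (metis Suc_eq_plus1 less_Suc_eq_le mult_less_cancel2)
  have small: "(\<Sum>i\<in>?S. u i choose k) < m choose k \<and> (?S = {} \<or> (\<exists>c\<in>I. ?S = {c}))"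
  proof (cases "?S = {}")
    case True
    then show ?thesis unfolding True using km by simp
  next
    case False
    then obtain c where c: "c \<in> I" "u c \<noteq> m" by blast
    have lt: "i \<in> I \<and> u i < m" if "i \<in> ?S" for i using that u[of i] by auto
    have cS: "c \<in> ?S" using c by simp
    have "i = c" if "i \<in> ?S" for i
      by (rule one) (use lt[OF that] lt[OF cS] in simp_all)
    with cS have Sc: "?S = {c}" by blast
    have "u c choose k < m choose k" using u[OF c(1)] c pos km by (intro choose_strict_mono) auto
    then show ?thesis unfolding Sc using c(1) by simp
  qed
  show Beq: "card ?B = \<alpha>"
  proof (rule ccontr)
    assume "card ?B \<noteq> \<alpha>"
    then have "card ?B + 1 \<le> \<alpha>" using q by simp
    then have "(card ?B + 1) * (m choose k) \<le> \<alpha> * (m choose k)" by (rule mult_le_mono1)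
    then show False using ge small by (simp add: algebra_simps)
  qed
  show "\<exists>i\<in>I. u i = \<beta>" if "k \<le> \<beta>"
  proof -
    have ge': "\<beta> choose k \<le> (\<Sum>i\<in>?S. u i choose k)" using ge Beq by simp
    have "\<beta> choose k > 0" using that by simp
    have "?S \<noteq> {}"
    proof
      assume "?S = {}"
      then show False using ge' \<open>\<beta> choose k > 0\<close> by (simp only: sum.empty)
    qed
    then obtain c where c: "c \<in> I" "?S = {c}" using small by blast
    have "u c \<le> \<beta>" using le Beq c(2) by simp
    moreover have "\<beta> choose k \<le> u c choose k" using ge' c(2) by simp
    ultimately have "u c = \<beta>" using choose_strict_mono[of "u c" \<beta> k] that pos by fastforce
    then show ?thesis using c by blast
  qed
qed

section \<open>Isomorphisms and copies of complete graphs\<close>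

lemma edge_neq: "simple_graph G \<Longrightarrow> {x, y} \<in> edges G \<Longrightarrow> x \<noteq> y \<and> x \<in> verts G \<and> y \<in> verts G"
  by (auto simp: simple_graph_def)

lemma edge_is_pair:
  assumes "simple_graph G" "e \<in> edges G"
  obtains x y where "e = {x, y}" "x \<noteq> y" "x \<in> verts G" "y \<in> verts G"
proof -
  have "e \<subseteq> verts G" "card e = 2" using assms by (auto simp: simple_graph_def)
  then show ?thesis using that by (auto simp: card_2_iff)
qed

lemma graph_iso_iff_adjacency:
  assumes G: "simple_graph G" and H: "simple_graph H"
  shows "graph_iso G H \<longleftrightarrow> (\<exists>f. bij_betw f (verts G) (verts H) \<and>
    (\<forall>x\<in>verts G. \<forall>y\<in>verts G. {x, y} \<in> edges G \<longleftrightarrow> {f x, f y} \<in> edges H))"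
proof -
  have "(\<lambda>e. f ` e) ` edges G = edges H \<longleftrightarrow>
    (\<forall>x\<in>verts G. \<forall>y\<in>verts G. {x, y} \<in> edges G \<longleftrightarrow> {f x, f y} \<in> edges H)" (is "?L \<longleftrightarrow> ?R")
    if f: "bij_betw f (verts G) (verts H)" for f
  proof
    have inj: "inj_on f (verts G)" and im: "f ` verts G = verts H" using f by (auto simp: bij_betw_def)
    { assume L: ?L
      show ?R
      proof (intro ballI iffI)
        fix x y assume xy: "x \<in> verts G" "y \<in> verts G"
        { assume "{x, y} \<in> edges G"
          then have "f ` {x, y} \<in> edges H" using L by blast
          then show "{f x, f y} \<in> edges H" by simp }
        { assume "{f x, f y} \<in> edges H"
          then have "f ` {x, y} \<in> (\<lambda>e. f ` e) ` edges G" using L by simp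
          then obtain e where e: "e \<in> edges G" "f ` {x, y} = f ` e" by (elim imageE)
          have "e \<subseteq> verts G" using e(1) G by (auto simp: simple_graph_def)
          then have "{x, y} = e" using inj_on_image_eq_iff[OF inj, of "{x, y}" e] e(2) xy by simp
          then show "{x, y} \<in> edges G" using e(1) by simp }
      qed }
    { assume R: ?R
      show ?L
      proof (intro set_eqI iffI)
        fix e assume "e \<in> (\<lambda>e. f ` e) ` edges G"
        then obtain e' where e': "e' \<in> edges G" "e = f ` e'" by (elim imageE)
        obtain x y where "e' = {x, y}" "x \<in> verts G" "y \<in> verts G" using edge_is_pair[OF G e'(1)] by metis
        then show "e \<in> edges H" using R e' by auto
      next
        fix e assume e: "e \<in> edges H"
        obtain a b where ab: "e = {a, b}" "a \<in> verts H" "b \<in> verts H" using edge_is_pair[OF H e] by metis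
        then obtain x y where xy: "x \<in> verts G" "y \<in> verts G" "a = f x" "b = f y" unfolding im[symmetric] by (elim imageE)
        then have "{x, y} \<in> edges G" using R ab e by simp
        then show "e \<in> (\<lambda>e. f ` e) ` edges G" using ab(1) xy by (auto intro!: image_eqI[of _ _ "{x, y}"])
      qed }
  qed
  then show ?thesis unfolding graph_iso_def by (intro ex_cong1 conj_cong refl) 
qed

lemma simple_complete_graph: "simple_graph (complete_graph k)"
  by (simp add: simple_graph_def complete_graph_def)

lemma edges_complete_graph: "{x, y} \<in> edges (complete_graph k) \<longleftrightarrow> x < k \<and> y < k \<and> x \<noteq> y"
  by (auto simp: complete_graph_def card_insert_if)

text \<open>
  A copy of a complete graph is determined by its vertex set.
\<close>
lemma num_copies_complete_graph:
  assumes G: "simple_graph G"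
  shows "num_copies (complete_graph k) G = card {C. clique G C \<and> card C = k}"
proof -
  let ?K = "\<lambda>C. Graph C {e. e \<subseteq> C \<and> card e = 2}"
  have fin: "finite C" if "clique G C" for C
    using that G finite_subset by (auto simp: clique_def simple_graph_def)
  have simpleK: "simple_graph (?K C)" if "clique G C" for C
    using fin[OF that] by (simp add: simple_graph_def)
  have "{S. subgraph S G \<and> graph_iso S (complete_graph k)} = ?K ` {C. clique G C \<and> card C = k}"
  proof (intro set_eqI iffI)
    fix S assume "S \<in> {S. subgraph S G \<and> graph_iso S (complete_graph k)}"
    then have S: "simple_graph S" "verts S \<subseteq> verts G" "edges S \<subseteq> edges G"
      and iso: "graph_iso S (complete_graph k)" by (auto simp: subgraph_def)
    obtain f where f: "bij_betw f (verts S) {..<k}"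
      and E: "\<And>x y. x \<in> verts S \<Longrightarrow> y \<in> verts S \<Longrightarrow> {x, y} \<in> edges S \<longleftrightarrow> f x < k \<and> f y < k \<and> f x \<noteq> f y"
      using iso unfolding graph_iso_iff_adjacency[OF S(1) simple_complete_graph] edges_complete_graph
      by (auto simp: complete_graph_def)
    have adj: "{x, y} \<in> edges S" if "x \<in> verts S" "y \<in> verts S" "x \<noteq> y" for x y
      using E[OF that(1,2)] f that by (auto simp: bij_betw_def inj_on_def)
    have "edges S = {e. e \<subseteq> verts S \<and> card e = 2}"
      using adj S(1) by (auto simp: simple_graph_def card_2_iff)
    then have "S = ?K (verts S)" by (cases S) simp
    moreover have "clique G (verts S)" using S adj by (auto simp: clique_def)
    moreover have "card (verts S) = k" using bij_betw_same_card[OF f] by simp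
    ultimately show "S \<in> ?K ` {C. clique G C \<and> card C = k}" by blast
  next
    fix S assume "S \<in> ?K ` {C. clique G C \<and> card C = k}"
    then obtain C where C: "S = ?K C" "clique G C" "card C = k" by blast
    obtain f where f: "bij_betw f C {..<k}"
      using finite_same_card_bij[OF fin[OF C(2)], of "{..<k}"] C(3) by auto
    have "graph_iso S (complete_graph k)"
      unfolding C(1) graph_iso_iff_adjacency[OF simpleK[OF C(2)] simple_complete_graph] edges_complete_graph
    proof (intro exI[of _ f] conjI ballI)
      show "bij_betw f (verts (?K C)) (verts (complete_graph k))" using f by (simp add: complete_graph_def)
      fix x y assume "x \<in> verts (?K C)" "y \<in> verts (?K C)"
      then show "{x, y} \<in> edges (?K C) \<longleftrightarrow> f x < k \<and> f y < k \<and> f x \<noteq> f y"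
        using f by (auto simp: card_insert_if bij_betw_def inj_on_def)
    qed
    moreover have "{e. e \<subseteq> C \<and> card e = 2} \<subseteq> edges G"
      using C(2) by (auto simp: clique_def card_2_iff)
    ultimately show "S \<in> {S. subgraph S G \<and> graph_iso S (complete_graph k)}"
      using C(2) simpleK[OF C(2)] unfolding C(1) subgraph_def clique_def by simp
  qed
  moreover have "inj_on ?K {C. clique G C \<and> card C = k}" by (auto simp: inj_on_def)
  ultimately show ?thesis unfolding num_copies_def by (simp add: card_image)
qed

section \<open>The upper bound and its extremal graphs\<close>

definition block :: "'a graph \<Rightarrow> ('a \<Rightarrow> nat) \<Rightarrow> nat \<Rightarrow> 'a set" where
  "block G l i = {x \<in> verts G. l x = i}"

text \<open>
  A labelling witnesses that \<open>G\<close> is, up to isomorphism, \<open>\<alpha>\<close> disjoint copies of the complete graph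
  on \<open>m\<close> vertices, carrying the labels below \<open>\<alpha>\<close>, together with a graph on \<open>\<beta>\<close> vertices, carrying the
  label \<open>\<alpha>\<close>, that is complete if it is large enough to contain \<open>k\<close>-cliques. It refers to \<open>G\<close> alone,
  which makes counting cliques and excluding the tree easier than with an isomorphism.
\<close>
definition block_labelling :: "nat \<Rightarrow> nat \<Rightarrow> nat \<Rightarrow> nat \<Rightarrow> 'a graph \<Rightarrow> ('a \<Rightarrow> nat) \<Rightarrow> bool" where
  "block_labelling k m \<alpha> \<beta> G l \<longleftrightarrow>
     (\<forall>x\<in>verts G. l x \<le> \<alpha>) \<and> (\<forall>x y. {x, y} \<in> edges G \<longrightarrow> l x = l y) \<and>
     (\<forall>i<\<alpha>. card (block G l i) = m \<and> clique G (block G l i)) \<and>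
     card (block G l \<alpha>) = \<beta> \<and> (k \<le> \<beta> \<longrightarrow> clique G (block G l \<alpha>))"

text \<open>
  If the number of \<open>k\<close>-cliques equals the bound, then every \<open>k\<close>-subset of a cluster is a clique. As
  \<open>k \<ge> 2\<close>, any two vertices of the cluster lie in such a subset, so the cluster is a clique.
\<close>
lemma (in tree_free_graph) card_kcliques_cluster_bound:
  assumes \<U>: "finite \<U>" "pairwise disjnt \<U>" "\<And>X. X \<in> \<U> \<Longrightarrow> X \<subseteq> verts G"
    "\<And>A. A \<in> kcliques \<Longrightarrow> \<exists>X\<in>\<U>. A \<subseteq> X"
  shows "card kcliques \<le> (\<Sum>X\<in>\<U>. card X choose k)"
    and "(\<Sum>X\<in>\<U>. card X) \<le> card (verts G)"
    and "(\<Sum>X\<in>\<U>. card X choose k) \<le> card kcliques \<Longrightarrow> X \<in> \<U> \<Longrightarrow> k \<le> card X \<Longrightarrow> clique G X"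
proof -
  have finX: "finite X" if "X \<in> \<U>" for X using \<U>(3)[OF that] finite_verts finite_subset by blast
  let ?f = "\<lambda>X. card {A \<in> kcliques. A \<subseteq> X}"
  have sub: "{A \<in> kcliques. A \<subseteq> X} \<subseteq> {B. B \<subseteq> X \<and> card B = k}" for X
    using kclique_facts(2) by blast
  have fin: "finite {B. B \<subseteq> X \<and> card B = k}" if "X \<in> \<U>" for X
    using finX[OF that] by (auto intro: finite_subset[of _ "Pow X"])
  have le: "?f X \<le> card X choose k" if "X \<in> \<U>" for X
    using card_mono[OF fin[OF that] sub] n_subsets[OF finX[OF that], of k] by simp
  have "kcliques = (\<Union>X\<in>\<U>. {A \<in> kcliques. A \<subseteq> X})" using \<U>(4) by blast
  then have 1: "card kcliques \<le> (\<Sum>X\<in>\<U>. ?f X)" using card_UN_le[OF \<U>(1)] by metis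
  show "card kcliques \<le> (\<Sum>X\<in>\<U>. card X choose k)"
    using 1 sum_mono[of \<U> ?f "\<lambda>X. card X choose k"] le by fastforce
  have "(\<Sum>X\<in>\<U>. card X) = card (\<Union>\<U>)" using card_Union_disjoint[OF \<U>(2)] finX by simp
  also have "\<dots> \<le> card (verts G)" using \<U>(3) finite_verts by (intro card_mono) auto
  finally show "(\<Sum>X\<in>\<U>. card X) \<le> card (verts G)" .
  show "clique G X" if tight: "(\<Sum>X\<in>\<U>. card X choose k) \<le> card kcliques" and X: "X \<in> \<U>" "k \<le> card X"
  proof -
    have "(\<Sum>X\<in>\<U>. ?f X) = (\<Sum>X\<in>\<U>. card X choose k)"
      using 1 tight sum_mono[of \<U> ?f "\<lambda>X. card X choose k"] le by fastforce
    then have "?f X = card X choose k" 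
      using sum_mono_inv[where f = ?f and g = "\<lambda>X. card X choose k"] le X(1) \<U>(1) by blast
    then have eq: "{A \<in> kcliques. A \<subseteq> X} = {B. B \<subseteq> X \<and> card B = k}"
      using card_subset_eq[OF fin[OF X(1)] sub] n_subsets[OF finX[OF X(1)], of k] by simp
    show ?thesis
      unfolding clique_def
    proof (intro conjI ballI impI)
      show "X \<subseteq> verts G" by (rule \<U>(3)[OF X(1)])
      fix x y assume xy: "x \<in> X" "y \<in> X" "x \<noteq> y"
      have "2 \<le> k" using two_d_le d by linarith
      then obtain B where B: "{x, y} \<subseteq> B" "B \<subseteq> X" "card B = k"
        using exists_subset_between[of "{x, y}" k X] X(2) xy finX[OF X(1)] by auto
      then have "clique G B" using eq kclique_facts(3) by blast
      then show "{x, y} \<in> edges G" using B(1) xy(3) by (auto simp: clique_def)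
    qed
  qed
qed

lemma (in tree_free_graph) card_kcliques_le:
  "card kcliques \<le> packing_value (k + d - 1) k (card (verts G))"
proof -
  obtain \<U> where \<U>: "finite \<U>" "pairwise disjnt \<U>"
    "\<And>X. X \<in> \<U> \<Longrightarrow> X \<subseteq> verts G \<and> k \<le> card X \<and> card X < k + d"
    "\<And>A. A \<in> kcliques \<Longrightarrow> \<exists>X\<in>\<U>. A \<subseteq> X" using kclique_clusters by blast
  have pos: "0 < k + d - 1" "0 < k" using two_d_le d by auto
  note bounds = card_kcliques_cluster_bound[OF \<U>(1,2) _ \<U>(4)]
  have "card kcliques \<le> (\<Sum>X\<in>\<U>. card X choose k)" using bounds(1) \<U>(3) by blast
  also have "\<dots> \<le> packing_value (k + d - 1) k (\<Sum>X\<in>\<U>. card X)"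
    using packing_value_add_sum[OF pos \<U>(1), of card 0] \<U>(3) pos by (fastforce simp: packing_value_def)
  also have "\<dots> \<le> packing_value (k + d - 1) k (card (verts G))"
    using bounds(2) \<U>(3) by (intro packing_value_mono pos) blast
  finally show ?thesis .
qed

text \<open>
  The clusters of size \<open>m\<close> become the blocks with labels below \<open>\<alpha>\<close>. They are cliques that no edge
  leaves, and the remaining \<open>\<beta>\<close> vertices form the last block. If \<open>k \<le> \<beta>\<close>, there is a cluster of size
  \<open>\<beta>\<close>, which has to fill that block.
\<close>
lemma (in tree_free_graph) extremal_block_labelling:
  assumes m: "m = k + d - 1" and \<beta>: "\<beta> < m" and n: "card (verts G) = \<alpha> * m + \<beta>"
    and val: "\<alpha> * (m choose k) + (\<beta> choose k) \<le> card kcliques"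
  shows "\<exists>l. block_labelling k m \<alpha> \<beta> G l"
proof -
  obtain \<U> where \<U>: "finite \<U>" "pairwise disjnt \<U>"
    "\<And>X. X \<in> \<U> \<Longrightarrow> X \<subseteq> verts G \<and> k \<le> card X \<and> card X < k + d"
    "\<And>A. A \<in> kcliques \<Longrightarrow> \<exists>X\<in>\<U>. A \<subseteq> X" using kclique_clusters by blast
  have k2: "2 \<le> k" using two_d_le d by linarith
  have km: "k \<le> m" using m d by linarith
  have UV: "X \<subseteq> verts G" if "X \<in> \<U>" for X using \<U>(3)[OF that] by blast
  have Um: "k \<le> card X \<and> card X \<le> m" if "X \<in> \<U>" for X using \<U>(3)[OF that] m by auto
  note bounds = card_kcliques_cluster_bound[OF \<U>(1,2) UV \<U>(4)]
  have sum: "(\<Sum>X\<in>\<U>. card X) \<le> \<alpha> * m + \<beta>" using bounds(2) n by simp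
  have val': "\<alpha> * (m choose k) + (\<beta> choose k) \<le> (\<Sum>X\<in>\<U>. card X choose k)"
    using val bounds(1) by (rule order_trans)
  note ext = packing_sum_extremal[OF k2 \<U>(1) Um \<beta> sum val' km]
  have "(\<Sum>X\<in>\<U>. card X choose k) \<le> packing_value m k (\<Sum>X\<in>\<U>. card X)"
    using packing_value_add_sum[OF _ _ \<U>(1), of m k card 0] Um k2 km by (fastforce simp: packing_value_def)
  also have "\<dots> \<le> packing_value m k (\<alpha> * m + \<beta>)"
    using k2 km by (intro packing_value_mono sum) auto
  also have "\<dots> = \<alpha> * (m choose k) + (\<beta> choose k)" by (rule packing_value_eq[OF \<beta>])
  finally have tight: "(\<Sum>X\<in>\<U>. card X choose k) \<le> card kcliques" using val by simp
  have cliqueU: "clique G X" if "X \<in> \<U>" for X using bounds(3) tight that Um[OF that] by blast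
  define L where "L = {X \<in> \<U>. card X = m}"
  have cL: "card L = \<alpha>" unfolding L_def by (rule ext(1))
  have finL: "finite L" using \<U>(1) by (simp add: L_def)
  have disj: "X = Y" if "X \<in> \<U>" "Y \<in> \<U>" "x \<in> X" "x \<in> Y" for X Y x
    using \<U>(2) that by (auto simp: pairwise_def disjnt_def)
  obtain h where h: "bij_betw h L {..<\<alpha>}" using finite_same_card_bij[OF finL, of "{..<\<alpha>}"] cL by auto
  define l where "l x = (if x \<in> \<Union>L then h (THE X. X \<in> L \<and> x \<in> X) else \<alpha>)" for x
  have lX: "l x = h X" if "X \<in> L" "x \<in> X" for X x
  proof -
    have "(THE X. X \<in> L \<and> x \<in> X) = X"
      using that disj by (intro the_equality) (auto simp: L_def)
    then show ?thesis using that by (auto simp: l_def)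
  qed
  have hX: "h X < \<alpha>" if "X \<in> L" for X using h that by (auto simp: bij_betw_def)
  have lR: "l x = \<alpha>" if "x \<notin> \<Union>L" for x using that by (simp add: l_def)
  have blockX: "block G l (h X) = X" if X: "X \<in> L" for X
  proof (intro set_eqI iffI)
    fix x assume "x \<in> block G l (h X)"
    then have x: "l x = h X" by (simp add: block_def)
    then have "x \<in> \<Union>L" using lR hX[OF X] by fastforce
    then obtain Y where Y: "Y \<in> L" "x \<in> Y" by blast
    then have "h Y = h X" using lX x by simp
    then have "Y = X" using h Y X by (auto simp: bij_betw_def inj_on_def)
    then show "x \<in> X" using Y by simp
  next
    fix x assume "x \<in> X"
    then show "x \<in> block G l (h X)" using lX[OF X] UV X by (auto simp: block_def L_def)
  qed
  have blockR: "block G l \<alpha> = verts G - \<Union>L"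
  proof (intro set_eqI iffI)
    fix x assume x: "x \<in> block G l \<alpha>"
    have "x \<notin> X" if "X \<in> L" for X using lX[OF that] hX[OF that] x by (auto simp: block_def)
    then show "x \<in> verts G - \<Union>L" using x by (auto simp: block_def)
  qed (use lR in \<open>auto simp: block_def\<close>)
  have finX: "finite X" if "X \<in> L" for X
    using UV[of X] that finite_verts finite_subset by (auto simp: L_def)
  have "card (\<Union>L) = (\<Sum>X\<in>L. card X)"
    using finX \<U>(2) by (intro card_Union_disjoint) (auto simp: L_def pairwise_def)
  also have "\<dots> = \<alpha> * m" using cL by (simp add: L_def)
  finally have cUL: "card (\<Union>L) = \<alpha> * m" .
  have LV: "\<Union>L \<subseteq> verts G" using UV by (auto simp: L_def)
  have cR: "card (block G l \<alpha>) = \<beta>"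
    unfolding blockR card_Diff_subset[OF finite_subset[OF LV finite_verts] LV] cUL n by simp
  have "block_labelling k m \<alpha> \<beta> G l"
    unfolding block_labelling_def
  proof (intro conjI ballI allI impI)
    fix x show "l x \<le> \<alpha>" using lX hX lR[of x] by (cases "x \<in> \<Union>L") (auto intro: less_imp_le)
  next
    fix x y assume e: "{x, y} \<in> edges G"
    have half: "y \<in> X" if "X \<in> L" "x \<in> X" "{x, y} \<in> edges G" for X x y
    proof (rule ccontr)
      assume "y \<notin> X"
      moreover have "clique G X" "card X = k + d - 1" using that cliqueU m by (auto simp: L_def)
      ultimately show False
        using no_edge_leaves_big_clique[of X x y] that by (simp add: insert_commute)
    qed
    have e': "{y, x} \<in> edges G" using e by (simp add: insert_commute)
    show "l x = l y"
    proof (cases "x \<in> \<Union>L \<or> y \<in> \<Union>L")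
      case True
      then obtain X where "X \<in> L" "x \<in> X" "y \<in> X" using half e e' by blast
      then show ?thesis using lX by simp
    next
      case False
      then show ?thesis using lR by simp
    qed
  next
    fix i assume "i < \<alpha>"
    then have "i \<in> h ` L" using h by (simp add: bij_betw_def)
    then obtain X where X: "X \<in> L" "i = h X" by (elim imageE)
    then show "card (block G l i) = m" "clique G (block G l i)"
      using blockX[OF X(1)] cliqueU by (auto simp: L_def)
  next
    show "card (block G l \<alpha>) = \<beta>" by (rule cR)
  next
    assume "k \<le> \<beta>"
    then obtain X where X: "X \<in> \<U>" "card X = \<beta>" using ext(2) by blast
    have "X \<subseteq> block G l \<alpha>"
      unfolding blockR using UV[OF X(1)] disj[OF X(1)] X(2) \<beta> by (fastforce simp: L_def)
    then have "X = block G l \<alpha>"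
      using X(2) cR finite_verts by (intro card_subset_eq) (auto simp: block_def)
    then show "clique G (block G l \<alpha>)" using cliqueU[OF X(1)] by simp
  qed
  then show ?thesis by blast
qed

section \<open>Graphs made of blocks attain the bound\<close>

text \<open>
  Every clique lies within one block, and so does every embedded tree, because the label of a vertex
  is passed on along the edges to the parents. If \<open>\<beta> < k\<close>, the last block contains no \<open>k\<close>-clique,
  whatever its edges are, in agreement with \<open>\<beta> choose k = 0\<close>.
\<close>
lemma block_labelling_properties:
  assumes G: "simple_graph G" and l: "block_labelling k m \<alpha> \<beta> G l"
  shows "card (verts G) = \<alpha> * m + \<beta>"
    and "2 \<le> k \<Longrightarrow> card {C. clique G C \<and> card C = k} = \<alpha> * (m choose k) + (\<beta> choose k)"
    and "m < t \<Longrightarrow> \<beta> < t \<Longrightarrow> (\<And>i. 0 < i \<Longrightarrow> i < t \<Longrightarrow> p i < i) \<Longrightarrow> \<not> embeds t p G"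
proof -
  have finV: "finite (verts G)" using G by (simp add: simple_graph_def)
  have L: "\<And>x. x \<in> verts G \<Longrightarrow> l x \<le> \<alpha>" "\<And>x y. {x, y} \<in> edges G \<Longrightarrow> l x = l y"
    "\<And>i. i < \<alpha> \<Longrightarrow> card (block G l i) = m" "\<And>i. i < \<alpha> \<Longrightarrow> clique G (block G l i)"
    "card (block G l \<alpha>) = \<beta>" "k \<le> \<beta> \<Longrightarrow> clique G (block G l \<alpha>)"
    using l by (auto simp: block_labelling_def)
  have finB: "finite (block G l i)" for i using finV by (simp add: block_def)
  have disjB: "block G l i \<inter> block G l j = {}" if "i \<noteq> j" for i j using that by (auto simp: block_def)
  have V: "verts G = (\<Union>i\<le>\<alpha>. block G l i)" using L(1) by (auto simp: block_def)
  have "card (verts G) = (\<Sum>i\<le>\<alpha>. card (block G l i))"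
    unfolding V using finB disjB by (intro card_UN_disjoint) auto
  also have "\<dots> = (\<Sum>i<\<alpha>. card (block G l i)) + \<beta>"
    using L(5) by (simp add: lessThan_Suc_atMost[symmetric])
  finally show "card (verts G) = \<alpha> * m + \<beta>" using L(3) by simp
  show "card {C. clique G C \<and> card C = k} = \<alpha> * (m choose k) + (\<beta> choose k)" if k: "2 \<le> k"
  proof -
    let ?S = "\<lambda>i. {C. C \<subseteq> block G l i \<and> card C = k}"
    have finS: "finite (?S i)" for i by (rule finite_subset[of _ "Pow (block G l i)"]) (auto simp: finB)
    have "{C. clique G C \<and> card C = k} = (\<Union>i\<le>\<alpha>. ?S i)"
    proof (intro set_eqI iffI)
      fix C assume "C \<in> {C. clique G C \<and> card C = k}"
      then have C: "clique G C" "card C = k" by auto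
      then have "C \<noteq> {}" using k by auto
      then obtain x where x: "x \<in> C" by blast
      have "l y = l x" if "y \<in> C" for y
      proof (cases "y = x")
        case False
        then show ?thesis using L(2)[of y x] C(1) x that by (simp add: clique_def)
      qed simp
      then have "C \<subseteq> block G l (l x)" using C(1) by (auto simp: block_def clique_def)
      moreover have "l x \<le> \<alpha>" using L(1) C(1) x by (auto simp: clique_def)
      ultimately show "C \<in> (\<Union>i\<le>\<alpha>. ?S i)" using C(2) by blast
    next
      fix C assume "C \<in> (\<Union>i\<le>\<alpha>. ?S i)"
      then obtain i where i: "i \<le> \<alpha>" "C \<subseteq> block G l i" "card C = k" by auto
      have "clique G (block G l i)"
      proof (cases "i < \<alpha>")
        case False
        then have "i = \<alpha>" using i(1) by simp
        then show ?thesis using L(5,6) card_mono[OF finB i(2)] i(3) by simp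
      qed (rule L(4))
      then show "C \<in> {C. clique G C \<and> card C = k}" using clique_subset i by blast
    qed
    moreover have "card (\<Union>i\<le>\<alpha>. ?S i) = (\<Sum>i\<le>\<alpha>. card (?S i))"
    proof (rule card_UN_disjoint)
      have "?S i \<inter> ?S j = {}" if "i \<noteq> j" for i j
      proof -
        have "False" if C: "C \<subseteq> block G l i" "card C = k" "C \<subseteq> block G l j" for C
        proof -
          have "C \<subseteq> {}" unfolding disjB[OF \<open>i \<noteq> j\<close>, symmetric] using C(1,3) by (rule Int_greatest)
          then show ?thesis using C(2) k by simp
        qed
        then show ?thesis by blast
      qed
      then show "\<forall>i\<in>{..\<alpha>}. \<forall>j\<in>{..\<alpha>}. i \<noteq> j \<longrightarrow> ?S i \<inter> ?S j = {}" by blast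
    qed (use finS in auto)
    moreover have "card (?S i) = card (block G l i) choose k" for i by (rule n_subsets[OF finB])
    moreover have "(\<Sum>i\<le>\<alpha>. card (block G l i) choose k) = (\<Sum>i<\<alpha>. card (block G l i) choose k) + (\<beta> choose k)"
      using L(5) by (simp add: lessThan_Suc_atMost[symmetric])
    ultimately show ?thesis using L(3) by simp
  qed
  show "\<not> embeds t p G" if t: "m < t" "\<beta> < t" and p: "\<And>i. 0 < i \<Longrightarrow> i < t \<Longrightarrow> p i < i"
  proof
    assume "embeds t p G"
    then obtain f where f: "inj_on f {..<t}" "f ` {..<t} \<subseteq> verts G"
      "\<And>i. 0 < i \<Longrightarrow> i < t \<Longrightarrow> {f i, f (p i)} \<in> edges G" by (auto simp: embeds_def)
    have "l (f i) = l (f 0)" if "i < t" for i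
      using that
    proof (induction i rule: less_induct)
      case (less i)
      show ?case
      proof (cases "i = 0")
        case False
        then have "l (f i) = l (f (p i))" using L(2) f(3) less.prems by simp
        also have "\<dots> = l (f 0)" using less.IH[of "p i"] p[of i] False less.prems by simp
        finally show ?thesis .
      qed simp
    qed
    then have "f ` {..<t} \<subseteq> block G l (l (f 0))" using f(2) by (auto simp: block_def)
    then have "card (f ` {..<t}) \<le> card (block G l (l (f 0)))" by (rule card_mono[OF finB])
    then have "t \<le> card (block G l (l (f 0)))" using f(1) by (simp add: card_image)
    moreover have "f 0 \<in> verts G" using f(2) t by auto
    then have "l (f 0) \<le> \<alpha>" by (rule L(1))
    then have "card (block G l (l (f 0))) < t" using L(3)[of "l (f 0)"] L(5) t by (cases "l (f 0) < \<alpha>") auto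
    ultimately show False by simp
  qed
qed

text \<open>
  Cut \<open>{..<\<alpha> * m + \<beta>}\<close> into consecutive intervals of length \<open>m\<close> and make each of them a clique.
\<close>
lemma block_graph_exists:
  assumes "\<beta> < m"
  obtains G :: "nat graph" and l where "simple_graph G" "block_labelling k m \<alpha> \<beta> G l"
proof -
  let ?n = "\<alpha> * m + \<beta>"
  define G where "G = Graph {..<?n} {e. e \<subseteq> {..<?n} \<and> card e = 2 \<and> (\<forall>x\<in>e. \<forall>y\<in>e. x div m = y div m)}"
  let ?l = "\<lambda>x. x div m"
  have m: "0 < m" using assms by simp
  have simple: "simple_graph G" by (auto simp: G_def simple_graph_def)
  have cl: "clique G (block G ?l i)" for i
    by (auto simp: clique_def block_def G_def card_insert_if)
  have div: "x div m = i \<longleftrightarrow> i * m \<le> x \<and> x < i * m + m" for x i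
    using m by (metis add.commute div_nat_eqI dividend_less_times_div div_times_less_eq_dividend mult.commute mult_Suc_right)
  have b1: "block G ?l i = {i * m..<i * m + m}" if "i < \<alpha>" for i
  proof -
    have "Suc i * m \<le> \<alpha> * m" using that by (intro mult_le_mono1) simp
    then show ?thesis by (auto simp: block_def G_def div)
  qed
  have b2: "block G ?l \<alpha> = {\<alpha> * m..<\<alpha> * m + \<beta>}"
    using assms by (auto simp: block_def G_def div)
  have le: "x div m \<le> \<alpha>" if "x \<in> verts G" for x
  proof -
    have "x < Suc \<alpha> * m" using that assms by (simp add: G_def)
    then show ?thesis using less_mult_imp_div_less[of x "Suc \<alpha>" m] by simp
  qed
  have same: "x div m = y div m" if "{x, y} \<in> edges G" for x y
  proof -
    have "\<forall>a\<in>{x, y}. \<forall>b\<in>{x, y}. a div m = b div m"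
      using that unfolding G_def graph.sel mem_Collect_eq by (elim conjE)
    then show ?thesis by blast
  qed
  have "block_labelling k m \<alpha> \<beta> G ?l"
    unfolding block_labelling_def
  proof (intro conjI ballI allI impI)
    show "card (block G ?l i) = m" if "i < \<alpha>" for i unfolding b1[OF that] by simp
    show "card (block G ?l \<alpha>) = \<beta>" unfolding b2 by simp
  qed (fact le, fact same, (rule cl)+)
  then show ?thesis using that simple by blast
qed

section \<open>Block labellings and disjoint unions\<close>

lemma simple_disjoint_copies: "simple_graph G \<Longrightarrow> simple_graph (disjoint_copies m G)"
proof -
  assume G: "simple_graph G"
  have "card (Pair i ` e) = card e" for i :: nat and e :: "'a set"
    by (intro card_image) (simp add: inj_on_def)
  then show ?thesis using G by (fastforce simp: simple_graph_def disjoint_copies_def)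
qed

lemma simple_disjoint_union: "simple_graph G \<Longrightarrow> simple_graph H \<Longrightarrow> simple_graph (disjoint_union G H)"
  by (auto simp: simple_graph_def disjoint_union_def card_image)

lemma edges_disjoint_union:
  "{Inl a, Inl b} \<in> edges (disjoint_union G H) \<longleftrightarrow> {a, b} \<in> edges G"
  "{Inr c, Inr c'} \<in> edges (disjoint_union G H) \<longleftrightarrow> {c, c'} \<in> edges H"
  "{Inl a, Inr c} \<notin> edges (disjoint_union G H)"
  "{Inr c, Inl a} \<notin> edges (disjoint_union G H)"
proof -
  have "Inl ` e = {Inl a, Inl b} \<longleftrightarrow> e = {a, b}" "Inr ` e' = {Inr c, Inr c'} \<longleftrightarrow> e' = {c, c'}"
    for e :: "'a set" and e' :: "'b set"
    using inj_image_eq_iff[of Inl e "{a, b}"] inj_image_eq_iff[of Inr e' "{c, c'}"] by simp_all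
  note eqs = this
  show "{Inl a, Inl b} \<in> edges (disjoint_union G H) \<longleftrightarrow> {a, b} \<in> edges G"
    by (auto simp: disjoint_union_def image_iff eqs eq_commute[of "{Inl a, Inl b}"])
  show "{Inr c, Inr c'} \<in> edges (disjoint_union G H) \<longleftrightarrow> {c, c'} \<in> edges H"
    by (auto simp: disjoint_union_def image_iff eqs eq_commute[of "{Inr c, Inr c'}"])
  show "{Inl a, Inr c} \<notin> edges (disjoint_union G H)" "{Inr c, Inl a} \<notin> edges (disjoint_union G H)"
    by (auto simp: disjoint_union_def)
qed

lemma edges_disjoint_copies:
  "{(i, a), (j, b)} \<in> edges (disjoint_copies m G) \<longleftrightarrow> i = j \<and> i < m \<and> {a, b} \<in> edges G"
proof
  assume "{(i, a), (j, b)} \<in> edges (disjoint_copies m G)"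
  then obtain h e where he: "{(i, a), (j, b)} = Pair h ` e" "h < m" "e \<in> edges G"
    by (auto simp: disjoint_copies_def)
  have "(i, a) \<in> Pair h ` e" "(j, b) \<in> Pair h ` e" unfolding he(1)[symmetric] by simp_all
  then have ij: "i = h" "j = h" by auto
  then have "Pair h ` e = Pair h ` {a, b}" using he(1) by simp
  then have "e = {a, b}" by (rule inj_image_eq_iff[THEN iffD1, rotated]) (simp add: inj_on_def)
  then show "i = j \<and> i < m \<and> {a, b} \<in> edges G" using he ij by simp
next
  assume "i = j \<and> i < m \<and> {a, b} \<in> edges G"
  then show "{(i, a), (j, b)} \<in> edges (disjoint_copies m G)"
    by (auto simp: disjoint_copies_def intro!: exI[of _ j] exI[of _ "{a, b}"])
qed

text \<open>
  From a labelling, enumerate every block to obtain the isomorphism; \<open>H\<close> is the last block with its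
  vertices renamed to \<open>{..<\<beta>}\<close>. Conversely, label each vertex by the copy that contains its image.
\<close>
lemma block_labelling_iff_iso:
  assumes G: "simple_graph G"
  shows "(\<exists>l. block_labelling k m \<alpha> \<beta> G l) \<longleftrightarrow>
    (\<exists>H :: nat graph. simple_graph H \<and> card (verts H) = \<beta> \<and> (k \<le> \<beta> \<longrightarrow> clique H (verts H)) \<and>
      graph_iso G (disjoint_union (disjoint_copies \<alpha> (complete_graph m)) H))"
proof
  let ?U = "disjoint_union (disjoint_copies \<alpha> (complete_graph m))"
  have simpleU: "simple_graph (?U H)" if "simple_graph H" for H :: "nat graph"
    by (intro simple_disjoint_union simple_disjoint_copies simple_complete_graph that)
  have vertsU: "verts (?U H) = ({..<\<alpha>} \<times> {..<m}) <+> verts H" for H :: "nat graph"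
    by (simp add: disjoint_union_def disjoint_copies_def complete_graph_def)
  note edgesU = edges_disjoint_union edges_disjoint_copies edges_complete_graph
  have finV: "finite (verts G)" using G by (simp add: simple_graph_def)
  have finB: "finite (block G l i)" for l i using finV by (simp add: block_def)
  {
    assume "\<exists>l. block_labelling k m \<alpha> \<beta> G l"
    then obtain l where "block_labelling k m \<alpha> \<beta> G l" ..
    then have L: "\<And>x. x \<in> verts G \<Longrightarrow> l x \<le> \<alpha>" "\<And>x y. {x, y} \<in> edges G \<Longrightarrow> l x = l y"
      "\<And>i. i < \<alpha> \<Longrightarrow> card (block G l i) = m" "\<And>i. i < \<alpha> \<Longrightarrow> clique G (block G l i)"
      "card (block G l \<alpha>) = \<beta>" "k \<le> \<beta> \<Longrightarrow> clique G (block G l \<alpha>)"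
      by (auto simp: block_labelling_def)
    define s where "s i = (if i < \<alpha> then m else \<beta>)" for i
    have "\<exists>h. bij_betw h (block G l i) {..<s i}" if "i \<le> \<alpha>" for i
      using L(3)[of i] L(5) that by (intro finite_same_card_bij finB) (auto simp: s_def)
    then obtain h where h: "\<And>i. i \<le> \<alpha> \<Longrightarrow> bij_betw (h i) (block G l i) {..<s i}" by metis
    have hinj: "x = y" if "x \<in> verts G" "y \<in> verts G" "l x = l y" "h (l x) x = h (l y) y" for x y
      using h[OF L(1)[OF that(1)]] that by (auto simp: bij_betw_def inj_on_def block_def)
    have hlt: "h (l x) x < s (l x)" if "x \<in> verts G" for x
      using h[OF L(1)[OF that]] that by (auto simp: bij_betw_def block_def)
    have hsurj: "\<exists>x\<in>verts G. l x = i \<and> h i x = a" if "i \<le> \<alpha>" "a < s i" for i a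
    proof -
      have "a \<in> h i ` block G l i" using h[OF that(1)] that(2) by (simp add: bij_betw_def)
      then show ?thesis by (auto simp: block_def)
    qed
    define f where "f x = (if l x < \<alpha> then Inl (l x, h (l x) x) else Inr (h \<alpha> x))" for x
    define H where "H = Graph {..<\<beta>} {{h \<alpha> x, h \<alpha> y} | x y. x \<in> block G l \<alpha> \<and> y \<in> block G l \<alpha> \<and> {x, y} \<in> edges G}"
    have h\<alpha>: "h \<alpha> x < \<beta>" if "x \<in> block G l \<alpha>" for x
      using hlt[of x] that by (simp add: block_def s_def)
    have h\<alpha>inj: "x = y" if "x \<in> block G l \<alpha>" "y \<in> block G l \<alpha>" "h \<alpha> x = h \<alpha> y" for x y
      using hinj[of x y] that by (simp add: block_def)
    have edgesH: "{h \<alpha> x, h \<alpha> y} \<in> edges H \<longleftrightarrow> {x, y} \<in> edges G"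
      if "x \<in> block G l \<alpha>" "y \<in> block G l \<alpha>" for x y
    proof
      assume "{h \<alpha> x, h \<alpha> y} \<in> edges H"
      then obtain x' y' where xy: "{h \<alpha> x, h \<alpha> y} = {h \<alpha> x', h \<alpha> y'}" "x' \<in> block G l \<alpha>" "y' \<in> block G l \<alpha>"
        "{x', y'} \<in> edges G" by (auto simp: H_def)
      then have "{x, y} = {x', y'}" using h\<alpha>inj that by (auto simp: doubleton_eq_iff)
      then show "{x, y} \<in> edges G" using xy by simp
    qed (use that in \<open>auto simp: H_def\<close>)
    have simpleH: "simple_graph H"
      unfolding simple_graph_def
    proof (intro conjI ballI)
      fix e assume "e \<in> edges H"
      then obtain x y where e: "e = {h \<alpha> x, h \<alpha> y}" "x \<in> block G l \<alpha>" "y \<in> block G l \<alpha>" "{x, y} \<in> edges G"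
        by (auto simp: H_def)
      then have "h \<alpha> x \<noteq> h \<alpha> y" using h\<alpha>inj edge_neq[OF G] by blast
      then show "e \<subseteq> verts H" "card e = 2" using e h\<alpha> by (auto simp: H_def)
    qed (simp add: H_def)
    have "bij_betw f (verts G) (verts (?U H))"
      unfolding bij_betw_def
    proof
      show "inj_on f (verts G)"
      proof (rule inj_onI)
        fix x y assume xy: "x \<in> verts G" "y \<in> verts G" "f x = f y"
        have "l x = l y \<and> h (l x) x = h (l y) y"
          using xy L(1)[OF xy(1)] L(1)[OF xy(2)] by (auto simp: f_def split: if_splits)
        then show "x = y" using hinj xy by blast
      qed
      show "f ` verts G = verts (?U H)"
        unfolding vertsU
      proof (intro set_eqI iffI)
        fix z assume "z \<in> f ` verts G"
        then obtain x where x: "x \<in> verts G" "z = f x" by (elim imageE)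
        show "z \<in> ({..<\<alpha>} \<times> {..<m}) <+> verts H"
          using hlt[OF x(1)] L(1)[OF x(1)] x(2) by (auto simp: f_def s_def H_def split: if_splits)
      next
        fix z assume z: "z \<in> ({..<\<alpha>} \<times> {..<m}) <+> verts H"
        show "z \<in> f ` verts G"
        proof (cases z)
          case (Inl ia)
          then obtain i a where ia: "z = Inl (i, a)" "i < \<alpha>" "a < m" using z by auto
          then obtain x where x: "x \<in> verts G" "l x = i" "h i x = a" using hsurj[of i a] by (auto simp: s_def)
          then have "f x = z" using ia by (simp add: f_def)
          then show ?thesis using x(1) by blast
        next
          case (Inr a)
          then have "a < \<beta>" using z by (auto simp: H_def)
          then obtain x where x: "x \<in> verts G" "l x = \<alpha>" "h \<alpha> x = a" using hsurj[of \<alpha> a] by (auto simp: s_def)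
          then have "f x = z" using Inr by (simp add: f_def)
          then show ?thesis using x(1) by blast
        qed
      qed
    qed
    moreover have "{x, y} \<in> edges G \<longleftrightarrow> {f x, f y} \<in> edges (?U H)" if xy: "x \<in> verts G" "y \<in> verts G" for x y
    proof -
      consider "l x < \<alpha>" "l y < \<alpha>" | "l x < \<alpha>" "l y = \<alpha>" | "l x = \<alpha>" "l y < \<alpha>" | "l x = \<alpha>" "l y = \<alpha>"
        using L(1)[OF xy(1)] L(1)[OF xy(2)] by linarith
      then show ?thesis
      proof cases
        case 1
        have "{x, y} \<in> edges G \<longleftrightarrow> l x = l y \<and> x \<noteq> y"
        proof
          assume e: "{x, y} \<in> edges G"
          show "l x = l y \<and> x \<noteq> y" using L(2)[OF e] edge_neq[OF G e] by blast
        next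
          assume eq: "l x = l y \<and> x \<noteq> y"
          then have "x \<in> block G l (l x)" "y \<in> block G l (l x)" using xy by (simp_all add: block_def)
          then show "{x, y} \<in> edges G" using L(4)[OF 1(1)] eq unfolding clique_def by blast
        qed
        also have "\<dots> \<longleftrightarrow> l x = l y \<and> h (l x) x \<noteq> h (l y) y" using hinj[OF xy] by blast
        also have "\<dots> \<longleftrightarrow> {f x, f y} \<in> edges (?U H)"
        proof -
          have "h (l x) x < m" "h (l y) y < m" using hlt[OF xy(1)] hlt[OF xy(2)] 1 by (simp_all add: s_def)
          then show ?thesis using 1 by (simp add: f_def edgesU)
        qed
        finally show ?thesis .
      next
        case 2
        then have "{x, y} \<notin> edges G" using L(2)[of x y] less_irrefl by metis
        then show ?thesis using 2 by (simp add: f_def edgesU)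
      next
        case 3
        then have "{x, y} \<notin> edges G" using L(2)[of x y] less_irrefl by metis
        then show ?thesis using 3 by (simp add: f_def edgesU)
      next
        case 4
        then show ?thesis using edgesH[of x y] xy by (simp add: f_def edgesU block_def)
      qed
    qed
    ultimately have "graph_iso G (?U H)"
      unfolding graph_iso_iff_adjacency[OF G simpleU[OF simpleH]] by blast
    moreover have "clique H (verts H)" if "k \<le> \<beta>"
      unfolding clique_def
    proof (intro conjI ballI impI)
      fix a b assume ab: "a \<in> verts H" "b \<in> verts H" "a \<noteq> b"
      have "\<exists>x\<in>block G l \<alpha>. h \<alpha> x = c" if "c \<in> verts H" for c
        using hsurj[of \<alpha> c] that by (auto simp: s_def H_def block_def)
      then obtain x y where xy: "x \<in> block G l \<alpha>" "y \<in> block G l \<alpha>" "h \<alpha> x = a" "h \<alpha> y = b"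
        using ab by blast
      have "x \<noteq> y" using xy(3,4) ab(3) by blast
      then have "{x, y} \<in> edges G" using xy L(6)[OF that] unfolding clique_def by blast
      then show "{a, b} \<in> edges H" using edgesH[OF xy(1,2)] unfolding xy(3,4) by blast
    qed simp
    moreover have "card (verts H) = \<beta>" by (simp add: H_def)
    ultimately show "\<exists>H :: nat graph. simple_graph H \<and> card (verts H) = \<beta> \<and> (k \<le> \<beta> \<longrightarrow> clique H (verts H)) \<and>
      graph_iso G (?U H)" using simpleH by blast
  }
  {
    assume "\<exists>H :: nat graph. simple_graph H \<and> card (verts H) = \<beta> \<and> (k \<le> \<beta> \<longrightarrow> clique H (verts H)) \<and>
      graph_iso G (?U H)"
    then obtain H :: "nat graph" where H: "simple_graph H" "card (verts H) = \<beta>" "k \<le> \<beta> \<Longrightarrow> clique H (verts H)"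
      and iso: "graph_iso G (?U H)" by blast
    obtain f where f: "bij_betw f (verts G) (verts (?U H))"
      and fE: "\<And>x y. x \<in> verts G \<Longrightarrow> y \<in> verts G \<Longrightarrow> {x, y} \<in> edges G \<longleftrightarrow> {f x, f y} \<in> edges (?U H)"
      using iso unfolding graph_iso_iff_adjacency[OF G simpleU[OF H(1)]] by blast
    have inj: "inj_on f (verts G)" and im: "f ` verts G = ({..<\<alpha>} \<times> {..<m}) <+> verts H"
      using f by (auto simp: bij_betw_def vertsU)
    define l where "l x = (case f x of Inl ia \<Rightarrow> fst ia | Inr a \<Rightarrow> \<alpha>)" for x
    have fcases: "(\<exists>a<m. f x = Inl (l x, a) \<and> l x < \<alpha>) \<or> (\<exists>a\<in>verts H. f x = Inr a \<and> l x = \<alpha>)"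
      if "x \<in> verts G" for x
    proof -
      have "f x \<in> ({..<\<alpha>} \<times> {..<m}) <+> verts H" using im that by blast
      then show ?thesis by (auto simp: l_def)
    qed
    have cardB: "card (block G l i) = card (f ` block G l i)" for i
      using inj_on_subset[OF inj] by (subst card_image) (auto simp: block_def)
    have B: "f ` block G l i = Inl ` ({i} \<times> {..<m})" if i: "i < \<alpha>" for i
    proof (intro set_eqI iffI)
      fix z assume "z \<in> f ` block G l i"
      then obtain x where x: "x \<in> verts G" "l x = i" "z = f x" by (auto simp: block_def)
      then show "z \<in> Inl ` ({i} \<times> {..<m})" using fcases[OF x(1)] i by auto
    next
      fix z :: "nat \<times> nat + nat" assume "z \<in> Inl ` ({i} \<times> {..<m})"
      then obtain a where a: "z = Inl (i, a)" "a < m" by auto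
      then have "z \<in> f ` verts G" unfolding im using i by auto
      then obtain x where x: "x \<in> verts G" "z = f x" by (elim imageE)
      have "f x = Inl (i, a)" using x(2) a(1) by simp
      then have "l x = i" by (simp add: l_def)
      then show "z \<in> f ` block G l i" using x by (auto simp: block_def)
    qed
    have B\<alpha>: "f ` block G l \<alpha> = Inr ` verts H"
    proof (intro set_eqI iffI)
      fix z assume "z \<in> f ` block G l \<alpha>"
      then obtain x where x: "x \<in> verts G" "l x = \<alpha>" "z = f x" by (auto simp: block_def)
      then show "z \<in> Inr ` verts H" using fcases[OF x(1)] by auto
    next
      fix z :: "nat \<times> nat + nat" assume "z \<in> Inr ` verts H"
      then obtain a where a: "z = Inr a" "a \<in> verts H" by auto
      then have "z \<in> f ` verts G" unfolding im by auto
      then obtain x where x: "x \<in> verts G" "z = f x" by (elim imageE)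
      have "f x = Inr a" using x(2) a(1) by simp
      then have "l x = \<alpha>" by (simp add: l_def)
      then show "z \<in> f ` block G l \<alpha>" using x by (auto simp: block_def)
    qed
    have "block_labelling k m \<alpha> \<beta> G l"
      unfolding block_labelling_def
    proof (intro conjI ballI allI impI)
      fix x assume "x \<in> verts G"
      then show "l x \<le> \<alpha>" using fcases by fastforce
    next
      fix x y assume e: "{x, y} \<in> edges G"
      then have xy: "x \<in> verts G" "y \<in> verts G" using edge_neq[OF G] by blast+
      then have e': "{f x, f y} \<in> edges (?U H)" using fE e by simp
      then show "l x = l y" using fcases[OF xy(1)] fcases[OF xy(2)] by (auto simp: edgesU)
    next
      fix i assume i: "i < \<alpha>"
      show "card (block G l i) = m" unfolding cardB B[OF i] by (subst card_image) (auto simp: inj_on_def)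
      show "clique G (block G l i)"
        unfolding clique_def
      proof (intro conjI ballI impI)
        fix x y assume xy: "x \<in> block G l i" "y \<in> block G l i" "x \<noteq> y"
        then have V: "x \<in> verts G" "y \<in> verts G" "l x = i" "l y = i" by (auto simp: block_def)
        obtain a b where ab: "f x = Inl (i, a)" "f y = Inl (i, b)" "a < m" "b < m"
          using fcases[OF V(1)] fcases[OF V(2)] V i by auto
        have "a \<noteq> b" using inj_onD[OF inj _ V(1,2)] ab(1,2) xy(3) by fastforce
        then show "{x, y} \<in> edges G" unfolding fE[OF V(1,2)] using ab i by (simp add: edgesU)
      qed (auto simp: block_def)
    next
      show "card (block G l \<alpha>) = \<beta>" unfolding cardB B\<alpha> using H(2) by (simp add: card_image)
    next
      assume "k \<le> \<beta>"
      then have cl: "clique H (verts H)" by (rule H(3))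
      show "clique G (block G l \<alpha>)"
        unfolding clique_def
      proof (intro conjI ballI impI)
        fix x y assume xy: "x \<in> block G l \<alpha>" "y \<in> block G l \<alpha>" "x \<noteq> y"
        then have V: "x \<in> verts G" "y \<in> verts G" "l x = \<alpha>" "l y = \<alpha>" by (auto simp: block_def)
        obtain a b where ab: "f x = Inr a" "f y = Inr b" "a \<in> verts H" "b \<in> verts H"
          using fcases[OF V(1)] fcases[OF V(2)] V by auto
        have "a \<noteq> b" using inj_onD[OF inj _ V(1,2)] ab(1,2) xy(3) by fastforce
        then show "{x, y} \<in> edges G" unfolding fE[OF V(1,2)] using ab cl by (simp add: edgesU clique_def)
      qed (auto simp: block_def)
    qed
    then show "\<exists>l. block_labelling k m \<alpha> \<beta> G l" by blast
  }
qed

lemma graph_iso_trans: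
  assumes "graph_iso G H" "graph_iso H K"
  shows "graph_iso G K"
proof -
  obtain f where f: "bij_betw f (verts G) (verts H)" "(\<lambda>e. f ` e) ` edges G = edges H"
    using assms(1) unfolding graph_iso_def by (elim exE conjE)
  obtain g where g: "bij_betw g (verts H) (verts K)" "(\<lambda>e. g ` e) ` edges H = edges K"
    using assms(2) unfolding graph_iso_def by (elim exE conjE)
  have "(\<lambda>e. (g \<circ> f) ` e) ` edges G = edges K"
    unfolding g(2)[symmetric] f(2)[symmetric] by (simp add: image_image)
  then show ?thesis using bij_betw_trans[OF f(1) g(1)] unfolding graph_iso_def by (intro exI conjI)
qed

text \<open>
  Lets both forms of the extremal graphs come from the same description with an unspecified
  remainder \<open>H\<close>.
\<close>
lemma complete_remainder_iso:
  fixes K :: "'c graph"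
  assumes G: "simple_graph G" and K: "simple_graph K"
  shows "(\<exists>H :: nat graph. simple_graph H \<and> card (verts H) = \<beta> \<and> clique H (verts H) \<and>
      graph_iso G (disjoint_union K H)) \<longleftrightarrow> graph_iso G (disjoint_union K (complete_graph \<beta>))"
proof
  assume "graph_iso G (disjoint_union K (complete_graph \<beta>))"
  moreover have "clique (complete_graph \<beta>) (verts (complete_graph \<beta>))"
    unfolding clique_def edges_complete_graph by (simp add: complete_graph_def)
  moreover have "card (verts (complete_graph \<beta>)) = \<beta>" by (simp add: complete_graph_def)
  ultimately show "\<exists>H :: nat graph. simple_graph H \<and> card (verts H) = \<beta> \<and> clique H (verts H) \<and>
      graph_iso G (disjoint_union K H)" using simple_complete_graph by blast
next
  assume "\<exists>H :: nat graph. simple_graph H \<and> card (verts H) = \<beta> \<and> clique H (verts H) \<and>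
      graph_iso G (disjoint_union K H)"
  then obtain H :: "nat graph" where H: "simple_graph H" "card (verts H) = \<beta>" "clique H (verts H)"
    and iso: "graph_iso G (disjoint_union K H)" by blast
  have "finite (verts H)" using H(1) by (simp add: simple_graph_def)
  then obtain g where g: "bij_betw g (verts H) {..<\<beta>}"
    using finite_same_card_bij[of "verts H" "{..<\<beta>}"] H(2) by auto
  have gE: "{x, y} \<in> edges H \<longleftrightarrow> {g x, g y} \<in> edges (complete_graph \<beta>)"
    if "x \<in> verts H" "y \<in> verts H" for x y
  proof -
    have "{x, y} \<in> edges H \<longleftrightarrow> x \<noteq> y"
      using that H(3) edge_neq[OF H(1), of x y] unfolding clique_def by blast
    also have "\<dots> \<longleftrightarrow> g x \<noteq> g y"
      using inj_on_eq_iff[OF bij_betw_imp_inj_on[OF g] that] by simp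
    finally show ?thesis using bij_betwE[OF g] that by (simp add: edges_complete_graph)
  qed
  let ?f = "map_sum id g"
  have "graph_iso (disjoint_union K H) (disjoint_union K (complete_graph \<beta>))"
    unfolding graph_iso_iff_adjacency[OF simple_disjoint_union[OF K H(1)] simple_disjoint_union[OF K simple_complete_graph]]
  proof (intro exI[of _ ?f] conjI ballI)
    show "bij_betw ?f (verts (disjoint_union K H)) (verts (disjoint_union K (complete_graph \<beta>)))"
    proof -
      have "?f ` (verts K <+> verts H) = verts K <+> g ` verts H"
        by (auto simp: Plus_def image_Un image_image)
      moreover have "inj_on ?f (verts K <+> verts H)"
      proof (rule inj_onI)
        fix x y assume "x \<in> verts K <+> verts H" "y \<in> verts K <+> verts H" "?f x = ?f y"
        then show "x = y"
          using inj_onD[OF bij_betw_imp_inj_on[OF g]] by (cases x; cases y) auto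
      qed
      ultimately show ?thesis
        using g by (simp add: bij_betw_def disjoint_union_def complete_graph_def)
    qed
    fix x y assume "x \<in> verts (disjoint_union K H)" "y \<in> verts (disjoint_union K H)"
    then have "x \<in> verts K <+> verts H" "y \<in> verts K <+> verts H" by (simp_all add: disjoint_union_def)
    then show "{x, y} \<in> edges (disjoint_union K H) \<longleftrightarrow> {?f x, ?f y} \<in> edges (disjoint_union K (complete_graph \<beta>))"
      using gE by (cases x; cases y) (auto simp: edges_disjoint_union)
  qed
  then show "graph_iso G (disjoint_union K (complete_graph \<beta>))" using graph_iso_trans iso by blast
qed

section \<open>The generalized Turan number and its extremal graphs\<close>

theorem theorem1p6:
  fixes d t n \<alpha> \<beta> :: nat and T :: "'b graph"
  assumes "d \<ge> 2" and "t \<ge> d^2 - d + 3"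
    and "is_tree T" and "card (verts T) = t"
    and "n = \<alpha> * (t - 1) + \<beta>" and "\<alpha> \<ge> 1" and "\<beta> \<le> t - 2"
  shows "ex_number n (complete_graph (t - d)) T
           = \<alpha> * ((t - 1) choose (t - d)) + (\<beta> choose (t - d)) \<and>
    (\<forall>G :: 'a graph. extremal n (complete_graph (t - d)) T G \<longleftrightarrow>
      simple_graph G \<and>
      (if \<beta> < t - d
       then \<exists>H :: nat graph. simple_graph H \<and> card (verts H) = \<beta> \<and>
          graph_iso G (disjoint_union (disjoint_copies \<alpha> (complete_graph (t - 1))) H)
       else graph_iso G
          (disjoint_union (disjoint_copies \<alpha> (complete_graph (t - 1))) (complete_graph \<beta>))))"
proof -
  define k m where "k = t - d" and "m = t - 1"
  let ?val = "\<alpha> * (m choose k) + (\<beta> choose k)"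
  have "d * 1 \<le> d * d" by (rule mult_le_mono2) (use assms(1) in simp)
  then have dd: "d * d + 3 \<le> t + d" using assms(2) unfolding power2_eq_square by linarith
  have "d * 2 \<le> d * d" by (rule mult_le_mono2) (use assms(1) in simp)
  then have t: "t = k + d" and k: "d * d + 3 \<le> k + 2 * d" and m: "m = k + d - 1"
    using dd unfolding k_def m_def by linarith+
  have k2: "2 \<le> k"
    using four_mult_le_square_add_four[OF assms(1)] k assms(1) by linarith
  have \<beta>: "\<beta> < m" and mt: "m < t" "\<beta> < t" using assms(1,7) k2 t unfolding m_def by linarith+
  have n: "n = \<alpha> * m + \<beta>" using assms(5) by (simp add: m_def)
  obtain x p where x: "bij_betw x {..<t} (verts T)" and p: "\<And>i. 0 < i \<Longrightarrow> i < t \<Longrightarrow> p i < (i::nat)"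
    and E: "edges T = {{x i, x (p i)} | i. 0 < i \<and> i < t}"
    using tree_enumeration[OF assms(3,4)] by blast
  have upper: "num_copies (complete_graph k) G \<le> ?val \<and>
      (?val \<le> num_copies (complete_graph k) G \<longrightarrow> (\<exists>l. block_labelling k m \<alpha> \<beta> G l))"
    if G: "simple_graph G" "card (verts G) = n" "free_of T G" for G :: "'c graph"
  proof -
    have "\<not> embeds (k + d) p G"
      using G(3) free_of_iff_not_embeds[OF G(1) x p E] unfolding t[symmetric] by simp
    then interpret tree_free_graph G k d p
      using G(1) p assms(1) k unfolding t by unfold_locales
    have "num_copies (complete_graph k) G = card kcliques"
      unfolding num_copies_complete_graph[OF G(1)] kcliques_def ..
    moreover have "card kcliques \<le> ?val"
      using card_kcliques_le unfolding G(2) n m[symmetric] packing_value_eq[OF \<beta>] .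
    moreover have "?val \<le> card kcliques \<Longrightarrow> \<exists>l. block_labelling k m \<alpha> \<beta> G l"
      using extremal_block_labelling[OF m \<beta>] G(2) n by simp
    ultimately show ?thesis by simp
  qed
  have lower: "card (verts G) = n \<and> free_of T G \<and> num_copies (complete_graph k) G = ?val"
    if G: "simple_graph G" and l: "block_labelling k m \<alpha> \<beta> G l" for G :: "'c graph" and l
    using block_labelling_properties(1)[OF G l] block_labelling_properties(2)[OF G l k2]
      block_labelling_properties(3)[OF G l mt p] n free_of_iff_not_embeds[OF G x p E]
    unfolding num_copies_complete_graph[OF G] by simp
  have ex: "ex_number n (complete_graph k) T = ?val"
    unfolding ex_number_def
  proof (rule Max_eqI)
    let ?S = "{num_copies (complete_graph k) G | G :: nat graph. simple_graph G \<and> card (verts G) = n \<and> free_of T G}"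
    show le: "y \<le> ?val" if "y \<in> ?S" for y using that upper by blast
    then show "finite ?S" by (meson finite_nat_set_iff_bounded_le)
    obtain G :: "nat graph" and l where "simple_graph G" "block_labelling k m \<alpha> \<beta> G l"
      using block_graph_exists[OF \<beta>] .
    then show "?val \<in> ?S" using lower by (force intro!: exI[of _ G])
  qed
  have "extremal n (complete_graph k) T G \<longleftrightarrow> simple_graph G \<and>
      (if \<beta> < k
       then \<exists>H :: nat graph. simple_graph H \<and> card (verts H) = \<beta> \<and>
          graph_iso G (disjoint_union (disjoint_copies \<alpha> (complete_graph m)) H)
       else graph_iso G
          (disjoint_union (disjoint_copies \<alpha> (complete_graph m)) (complete_graph \<beta>)))" for G :: "'a graph"
  proof (cases "simple_graph G")
    case True
    have "extremal n (complete_graph k) T G \<longleftrightarrow> (\<exists>l. block_labelling k m \<alpha> \<beta> G l)"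
      unfolding extremal_def ex using upper[OF True] lower[OF True] True by auto
    also have "\<dots> \<longleftrightarrow> (if \<beta> < k
       then \<exists>H :: nat graph. simple_graph H \<and> card (verts H) = \<beta> \<and>
          graph_iso G (disjoint_union (disjoint_copies \<alpha> (complete_graph m)) H)
       else graph_iso G
          (disjoint_union (disjoint_copies \<alpha> (complete_graph m)) (complete_graph \<beta>)))"
      unfolding block_labelling_iff_iso[OF True]
      using complete_remainder_iso[OF True simple_disjoint_copies[OF simple_complete_graph]]
      by (simp add: not_less)
    finally show ?thesis using True by simp
  qed (simp add: extremal_def)
  then show ?thesis using ex unfolding k_def m_def by blast
qed

end
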